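(* In the setting described in the context, let $\{W_r,\mathcal S_r^o,\mathcal I_r\}_{r\ge1}$ be an admissible Galerkin scheme (i.e. satisfying (C), (CQ), (CD)), and assume the standing assumptions (R), (D) and condition (LC). Suppose that condition (H) holds, that there are constants $c,C$ with $0<c\le\lambda_r^*\le C<+\infty$ for all sufficiently large $r$, and that $\mathcal R$ satisfies the extended $(PS)_e$-condition at every level $\lambda\in[c,C]$. Then there exists $(u^*,v^* )\in\mathcal U^o\times(\mathcal S\setminus\{0\})$ such that $$c\le\lambda^*=\mathcal R(u^*,v^* )=\inf_{v\in\mathcal S\setminus\{0\}}\mathcal R(u^*,v)=\sup_{u\in\mathcal U^o}\inf_{v\in\mathcal S\setminus\{0\}}\mathcal R(u,v).$$ Moreover, $$\mathcal F(u^*,\lambda^* )=0\ \text{in }W^*,\qquad \langle D_u\mathcal F(u^*,\lambda^* )\xi,v^*\rangle=0\quad\forall\xi\in W.$$ In addition, the equation $\mathcal F(u,\lambda)=0$ has no solution $u\in\mathcal U^o$ for any $\lambda>\lambda^*$. Consequently, $(u^*,\lambda^* )$ is a maximal one-sided saddle-node point in $\mathcal U^o$. Finally, $\lambda_r^*\to\lambda^*$, and there exist a subsequence, still denoted by $r$, and pairs $(u_r^*,v_r^* )\in\mathcal S_r^o\times\mathcal S_r^o$ such that, after a positive rescaling of $v_r^*$, $$u_r^*\to u^*\ \text{strongly in }W,\qquad v_r^*\rightharpoonup v^*\ \text{weakly in }W.$$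
   Context: Setting. $W$ is a reflexive Banach space with dual $W^*$ and duality pairing $\langle\cdot,\cdot\rangle$; $\mathcal C^0$ is an ordered Banach function space ($W$ and $\mathcal C^0$ are regarded as subspaces of a common vector space, so that $W\cap\mathcal C^0$ makes sense). $\mathcal S^o\subset W\cap\mathcal C^0$ is a convex cone, $\mathcal S:=\overline{\mathcal S^o}^{\,\mathcal C^0}\cap W$, and $\overline{\operatorname{span}\mathcal S^o}^{\,W}=W$. A subclass $\mathcal U^o\subset\mathcal S^o$ is fixed. $\mathcal A,\mathcal G:W\to W^*$ are continuous and are continuously Fréchet differentiable on $\mathcal U^o$. Put $\mathcal F(u,\lambda):=\mathcal A(u)-\lambda\mathcal G(u)$, $\lambda\in\mathbb R$, and $D_u\mathcal F(u,\lambda)\xi=D_u\mathcal A(u)\xi-\lambda D_u\mathcal G(u)\xi$. The extended Rayleigh quotient is $$\mathcal R(u,v):=\frac{\langle\mathcal A(u),v\rangle}{\langle\mathcal G(u),v\rangle},\qquad \langle\mathcal G(u),v\rangle\ne0.$$ For $u\in\mathcal U^o$ put $\lambda(u):=\inf_{v\in\mathcal S\setminus\{0\}}\mathcal R(u,v)$, and $\lambda^*:=\sup_{u\in\mathcal U^o}\lambda(u)=\sup_{u\in\mathcal U^o}\inf_{v\in\mathcal S\setminus\{0\}}\mathcal R(u,v)$. Standing assumptions. (R): if $u\in\mathcal S^o$ weakly satisfies $\mathcal F(u,\lambda)=0$, then $u\in\mathcal U^o$. (D): $\langle\mathcal G(u),v\rangle>0$ for every $(u,v)\in\mathcal S^o\times(\mathcal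 S\setminus\{0\})$. Saddle-node points. A solution $(u_0,\lambda_0)\in\mathcal U^o\times\mathbb R$ of $\mathcal F(u,\lambda)=0$ is called singular if there is $v_0\in\mathcal S\setminus\{0\}$ with $\langle D_u\mathcal F(u_0,\lambda_0)\xi,v_0\rangle=0$ for all $\xi\in W$. It is called a one-sided saddle-node point in $\mathcal U^o$ if there exist $\varepsilon>0$ and a neighbourhood $V$ of $u_0$ in $W$ such that $\mathcal F(u,\lambda)=0$ has no solutions in $\mathcal U^o\cap V$ for $\lambda\in(\lambda_0,\lambda_0+\varepsilon)$. It is called maximal if every one-sided saddle-node point $(\hat u,\hat\lambda)\in\mathcal U^o\times\mathbb R$ satisfies $\hat\lambda\le\lambda_0$. Galerkin scheme. $W_r\subset W$ ($r\ge1$) are subspaces of finite dimension $N_r$ with $\bigcup_{r}W_r$ dense in $W$ in the sense that every $\xi\in W$ is the strong limit of some $\xi_r\in W_r$; $\mathcal I_r:\mathcal C^0\to W_r$ are interpolation operators. (C): (c1) for every $r\ge1$, $\mathcal S_r^o\subset W_r$ is a nonempty open cone, $\mathcal S_r:=\overline{\mathcal S_r^o}^{\,W_r}$, and $\mathcal S_r\subset\mathcal S$; (c2) there is a basis $\{\eta_1,\dots,\eta_{N_r}\}$ of $W_r$ with $\mathcal S_r^o=\{\sum_i v^i\eta_i: v^i>0,\ i=1,\dots,N_r\}$; (c3) for every $u\in\mathcal U^o$, $\mathcal I_ru$ is well defined and $\mathcal I_ru\in\mathcal S_r^o$ for all sufficiently large $r$. (CQ): for every $r\ge1$, $\langle\mathcal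 G(u),v\rangle>0$ for all $(u,v)\in\mathcal S_r^o\times(\mathcal S_r\setminus\{0\})$; moreover the finite-dimensional restrictions are $C^1$ on $\mathcal S_r^o$, i.e. for each $v\in W_r$ the functions $u\mapsto\langle\mathcal A(u),v\rangle$ and $u\mapsto\langle\mathcal G(u),v\rangle$ are $C^1$ on the open set $\mathcal S_r^o\subset W_r$; in particular $\mathcal R$ is $C^1$ on $\mathcal S_r^o\times\mathcal S_r^o$. For $u\in\mathcal S_r^o$ and $\xi,v\in W_r$, $\langle D_u\mathcal F(u,\lambda)\xi,v\rangle$ denotes the derivative of $u\mapsto\langle\mathcal F(u,\lambda),v\rangle$ at $u$ in direction $\xi$. (CD): for every $u\in\mathcal U^o$, $v\in\mathcal S$, $\xi\in W$, $\lambda\in\mathbb R$: whenever $u_n,v_n\in\mathcal S_{r_n}^o$, $\xi_n\in W_{r_n}$, $r_n\to\infty$, $\lambda_n\to\lambda$, $u_n\to u$ in $W$, $\xi_n\to\xi$ in $W$, $v_n\rightharpoonup v$ weakly in $W$, one has $\langle D_u\mathcal F(u_n,\lambda_n)\xi_n,v_n\rangle\to\langle D_u\mathcal F(u,\lambda)\xi,v\rangle$. The scheme is admissible if (C), (CQ), (CD) hold. For $u\in\mathcal S_r^o$ put $\lambda_r(u):=\inf_{v\in\mathcal S_r\setminus\{0\}}\mathcal R(u,v)$ and $\lambda_r^*:=\sup_{u\in\mathcal S_r^o}\lambda_r(u)$. (H): for all sufficiently large $r$: (h1) if $\lambda_r^*<+\infty$, there exists $\alpha_r<\lambda_r^*$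 such that $K_{r,\alpha_r}:=\{u\in\mathcal S_r^o:\lambda_r(u)\ge\alpha_r\}$ has compact closure in $W_r$ and this closure is contained in $\mathcal S_r^o$; (h2) if $u\in\mathcal S_r^o$, $v\in\mathcal S_r\setminus\{0\}$, $\mathcal R(u,v)=\lambda_r^*<+\infty$ and $D_u\mathcal R(u,v)(\xi)=0$ for all $\xi\in W_r$, then $v\in\mathcal S_r^o$. (LC): $\lambda^*<+\infty$, and there exists $\delta_0>0$ such that for every $u\in\mathcal U^o$ with $\lambda(u)\ge\lambda^*-\delta_0$ one has $\liminf_{r\to\infty}\lambda_r(\mathcal I_ru)\ge\lambda(u)$. Extended $(PS)_e$-condition at level $\lambda\in\mathbb R$: every sequence $r_n\to\infty$ and every sequence $(u_n,v_n)\in\mathcal S_{r_n}^o\times\mathcal S_{r_n}^o$ with $\mathcal R(u_n,v_n)\to\lambda$, $D_u\mathcal R(u_n,v_n)(\xi)=0$ for all $\xi\in W_{r_n}$, and $D_v\mathcal R(u_n,v_n)(\zeta)=0$ for all $\zeta\in W_{r_n}$, has a subsequence and numbers $t_n>0$ such that, after replacing $v_n$ by $t_nv_n$, $u_n\to\bar u$ strongly in $W$ and $v_n\rightharpoonup\bar v$ weakly in $W$, with $\bar u\in\mathcal S^o$ and $\bar v\in\mathcal S\setminus\{0\}$. *)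

theory Defs
  imports "HOL-Analysis.Analysis"
begin

section \<open>Functional-analytic notions\<close>

definition reflexive_space :: "'w::real_normed_vector itself \<Rightarrow> bool" where
  "reflexive_space _ \<longleftrightarrow>
     (\<forall>\<Phi> :: ('w \<Rightarrow>\<^sub>L real) \<Rightarrow>\<^sub>L real. \<exists>x :: 'w. \<forall>f.
        blinfun_apply \<Phi> f = blinfun_apply f x)"

definition weakly_tendsto :: "(nat \<Rightarrow> 'w::real_normed_vector) \<Rightarrow> 'w \<Rightarrow> bool" where
  "weakly_tendsto x l \<longleftrightarrow>
     (\<forall>f :: 'w \<Rightarrow>\<^sub>L real. (\<lambda>n. blinfun_apply f (x n)) \<longlonglongrightarrow> blinfun_apply f l)"

text \<open>Only strictly positive factors are allowed, so a cone need not contain 0 (unlike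
  \<^const>\<open>cone\<close> and \<^const>\<open>conic\<close>): the open cones below do not contain it.\<close>

definition pos_cone :: "'a::real_vector set \<Rightarrow> bool" where
  "pos_cone K \<longleftrightarrow> (\<forall>x\<in>K. \<forall>c>0. c *\<^sub>R x \<in> K)"

text \<open>Continuous Frechet differentiability at the points of \<open>U\<close>, relative to the space \<open>X\<close>.
  It is used with \<open>X = UNIV\<close> and with \<open>X\<close> a finite-dimensional subspace in which \<open>U\<close> is
  relatively open. In the second case a derivative is determined only on \<open>X\<close>, and the
  existence of a continuous choice among its bounded extensions to the whole space is
  the same as continuity of the derivative on \<open>X\<close>, as \<open>X\<close> is complemented.\<close>

definition C1_on_within ::
  "('a::real_normed_vector \<Rightarrow> 'b::real_normed_vector) \<Rightarrow> 'a set \<Rightarrow> 'a set \<Rightarrow> bool" where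
  "C1_on_within f U X \<longleftrightarrow>
     (\<exists>D :: 'a \<Rightarrow> 'a \<Rightarrow>\<^sub>L 'b. continuous_on U D \<and>
        (\<forall>u\<in>U. (f has_derivative blinfun_apply (D u)) (at u within X)))"

text \<open>The derivative at \<open>u\<close> in direction \<open>\<xi>\<close>. It is applied to functions that are \<open>C\<^sup>1\<close> on a
  finite-dimensional subspace containing \<open>\<xi>\<close>, near the point \<open>u\<close> of that subspace.\<close>

definition dir_deriv :: "('a::real_vector \<Rightarrow> real) \<Rightarrow> 'a \<Rightarrow> 'a \<Rightarrow> real" where
  "dir_deriv f u \<xi> = deriv (\<lambda>t. f (u + t *\<^sub>R \<xi>)) 0"


section \<open>The equation and the extended Rayleigh quotient\<close>

type_synonym 'w dual_map = "'w \<Rightarrow> 'w \<Rightarrow>\<^sub>L real"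

definition Fop :: "'w::real_normed_vector dual_map \<Rightarrow> 'w dual_map \<Rightarrow> 'w \<Rightarrow> real \<Rightarrow> 'w \<Rightarrow>\<^sub>L real" where
  "Fop A G u l = A u - l *\<^sub>R G u"

definition DuF ::
  "'w::real_normed_vector dual_map \<Rightarrow> 'w dual_map \<Rightarrow> 'w \<Rightarrow> real \<Rightarrow> 'w \<Rightarrow> 'w \<Rightarrow>\<^sub>L real" where
  "DuF A G u l \<xi> = frechet_derivative A (at u) \<xi> - l *\<^sub>R frechet_derivative G (at u) \<xi>"

definition Rq :: "'w::real_normed_vector dual_map \<Rightarrow> 'w dual_map \<Rightarrow> 'w \<Rightarrow> 'w \<Rightarrow> real" where
  "Rq A G u v = blinfun_apply (A u) v / blinfun_apply (G u) v"

text \<open>\<open>lam A G K u\<close> is \<open>\<lambda>(u)\<close> for \<open>K = \<S>\<close> and \<open>\<lambda>\<^sub>r(u)\<close> for \<open>K = \<S>\<^sub>r\<close>; likewise \<open>lam_star\<close> yields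
  \<open>\<lambda>\<^sup>*\<close> and \<open>\<lambda>\<^sub>r\<^sup>*\<close>. The values are extended reals, as neither infimum nor supremum is
  assumed to be finite.\<close>

definition lam ::
  "'w::real_normed_vector dual_map \<Rightarrow> 'w dual_map \<Rightarrow> 'w set \<Rightarrow> 'w \<Rightarrow> ereal" where
  "lam A G K u = (INF v\<in>K - {0}. ereal (Rq A G u v))"

definition lam_star ::
  "'w::real_normed_vector dual_map \<Rightarrow> 'w dual_map \<Rightarrow> 'w set \<Rightarrow> 'w set \<Rightarrow> ereal" where
  "lam_star A G U K = (SUP u\<in>U. lam A G K u)"


section \<open>The spaces and cones\<close>

text \<open>The spaces \<open>W\<close> and \<open>\<C>\<^sup>0\<close> are types \<open>'w\<close> and \<open>'c\<close>, embedded by injective linear maps \<open>iW\<close> and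
  \<open>iC\<close> in a common vector space \<open>'x\<close>. An element \<open>u\<close> of \<open>W\<close> lies in \<open>\<C>\<^sup>0\<close> if \<open>iW u \<in> range iC\<close>,
  and \<open>toC iW iC u\<close> is then the same element regarded as a member of \<open>\<C>\<^sup>0\<close>.\<close>

definition toC :: "('w \<Rightarrow> 'x) \<Rightarrow> ('c \<Rightarrow> 'x) \<Rightarrow> 'w \<Rightarrow> 'c" where
  "toC iW iC u = inv iC (iW u)"

definition cone_S ::
  "('w \<Rightarrow> 'x) \<Rightarrow> ('c::topological_space \<Rightarrow> 'x) \<Rightarrow> 'w set \<Rightarrow> 'w set" where
  "cone_S iW iC So = {w. iW w \<in> iC ` closure (toC iW iC ` So)}"

text \<open>The order of \<open>\<C>\<^sup>0\<close> comes from the type class; closedness of the positive cone is what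
  makes it an ordered Banach space.\<close>

definition setting ::
  "('w::banach \<Rightarrow> 'x::real_vector) \<Rightarrow> ('c::{banach, ordered_real_vector} \<Rightarrow> 'x) \<Rightarrow>
   'w set \<Rightarrow> 'w set \<Rightarrow> 'w dual_map \<Rightarrow> 'w dual_map \<Rightarrow> bool" where
  "setting iW iC So Uo A G \<longleftrightarrow>
     reflexive_space TYPE('w) \<and>
     closed {f :: 'c. 0 \<le> f} \<and>
     linear iW \<and> inj iW \<and> linear iC \<and> inj iC \<and>
     iW ` So \<subseteq> range iC \<and> convex So \<and> pos_cone So \<and>
     closure (span So) = UNIV \<and>
     Uo \<subseteq> So \<and>
     continuous_on UNIV A \<and> continuous_on UNIV G \<and>
     C1_on_within A Uo UNIV \<and> C1_on_within G Uo UNIV"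

definition cond_R :: "'w::real_normed_vector dual_map \<Rightarrow> 'w dual_map \<Rightarrow> 'w set \<Rightarrow> 'w set \<Rightarrow> bool" where
  "cond_R A G So Uo \<longleftrightarrow> (\<forall>u\<in>So. \<forall>l. Fop A G u l = 0 \<longrightarrow> u \<in> Uo)"

definition cond_D :: "'w::real_normed_vector dual_map \<Rightarrow> 'w set \<Rightarrow> 'w set \<Rightarrow> bool" where
  "cond_D G So S \<longleftrightarrow> (\<forall>u\<in>So. \<forall>v\<in>S - {0}. blinfun_apply (G u) v > 0)"


section \<open>Saddle-node points\<close>

definition is_solution ::
  "'w::real_normed_vector dual_map \<Rightarrow> 'w dual_map \<Rightarrow> 'w set \<Rightarrow> 'w \<Rightarrow> real \<Rightarrow> bool" where
  "is_solution A G Uo u l \<longleftrightarrow> u \<in> Uo \<and> Fop A G u l = 0"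

definition singular_solution ::
  "'w::real_normed_vector dual_map \<Rightarrow> 'w dual_map \<Rightarrow> 'w set \<Rightarrow> 'w set \<Rightarrow> 'w \<Rightarrow> real \<Rightarrow> bool" where
  "singular_solution A G Uo S u l \<longleftrightarrow>
     is_solution A G Uo u l \<and>
     (\<exists>v\<in>S - {0}. \<forall>\<xi>. blinfun_apply (DuF A G u l \<xi>) v = 0)"

text \<open>A saddle-node point is understood to be a singular solution.\<close>

definition one_sided_saddle_node ::
  "'w::real_normed_vector dual_map \<Rightarrow> 'w dual_map \<Rightarrow> 'w set \<Rightarrow> 'w set \<Rightarrow> 'w \<Rightarrow> real \<Rightarrow> bool" where
  "one_sided_saddle_node A G Uo S u0 l0 \<longleftrightarrow>
     singular_solution A G Uo S u0 l0 \<and>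
     (\<exists>\<epsilon>>0. \<exists>V. open V \<and> u0 \<in> V \<and>
        (\<forall>l\<in>{l0<..<l0 + \<epsilon>}. \<forall>u\<in>Uo \<inter> V. Fop A G u l \<noteq> 0))"

definition maximal_one_sided_saddle_node ::
  "'w::real_normed_vector dual_map \<Rightarrow> 'w dual_map \<Rightarrow> 'w set \<Rightarrow> 'w set \<Rightarrow> 'w \<Rightarrow> real \<Rightarrow> bool" where
  "maximal_one_sided_saddle_node A G Uo S u0 l0 \<longleftrightarrow>
     one_sided_saddle_node A G Uo S u0 l0 \<and>
     (\<forall>u l. one_sided_saddle_node A G Uo S u l \<longrightarrow> l \<le> l0)"


section \<open>The Galerkin scheme\<close>

text \<open>The index \<open>r\<close> ranges over \<open>r \<ge> 1\<close>; the value of the families at 0 is irrelevant.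
  \<open>Wr r\<close> is a subspace of \<open>W\<close> and \<open>Sor r\<close> the open cone in it.\<close>

definition galerkin_spaces ::
  "(nat \<Rightarrow> 'w::real_normed_vector set) \<Rightarrow> (nat \<Rightarrow> nat) \<Rightarrow> (nat \<Rightarrow> 'c \<Rightarrow> 'w) \<Rightarrow> bool" where
  "galerkin_spaces Wr N Ir \<longleftrightarrow>
     (\<forall>r\<ge>1. subspace (Wr r) \<and> (\<exists>B. finite B \<and> span B = Wr r) \<and> dim (Wr r) = N r) \<and>
     (\<forall>\<xi>. \<exists>x. (\<forall>r\<ge>1. x r \<in> Wr r) \<and> x \<longlonglongrightarrow> \<xi>) \<and>
     (\<forall>r\<ge>1. \<forall>f. Ir r f \<in> Wr r)"

definition Scl :: "(nat \<Rightarrow> 'w::topological_space set) \<Rightarrow> (nat \<Rightarrow> 'w set) \<Rightarrow> nat \<Rightarrow> 'w set" where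
  "Scl Wr Sor r = top_of_set (Wr r) closure_of Sor r"

definition cond_C ::
  "('w::real_normed_vector \<Rightarrow> 'x) \<Rightarrow> ('c \<Rightarrow> 'x) \<Rightarrow> 'w set \<Rightarrow> 'w set \<Rightarrow>
   (nat \<Rightarrow> 'w set) \<Rightarrow> (nat \<Rightarrow> nat) \<Rightarrow> (nat \<Rightarrow> 'w set) \<Rightarrow> (nat \<Rightarrow> 'c \<Rightarrow> 'w) \<Rightarrow> bool" where
  "cond_C iW iC Uo S Wr N Sor Ir \<longleftrightarrow>
     (\<forall>r\<ge>1. Sor r \<subseteq> Wr r \<and> Sor r \<noteq> {} \<and> openin (top_of_set (Wr r)) (Sor r) \<and>
        pos_cone (Sor r) \<and> Scl Wr Sor r \<subseteq> S) \<and>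
     (\<forall>r\<ge>1. \<exists>\<eta> :: nat \<Rightarrow> 'w.
        inj_on \<eta> {1..N r} \<and> independent (\<eta> ` {1..N r}) \<and> span (\<eta> ` {1..N r}) = Wr r \<and>
        Sor r = {(\<Sum>i=1..N r. a i *\<^sub>R \<eta> i) | a. \<forall>i\<in>{1..N r}. a i > 0}) \<and>
     (\<forall>u\<in>Uo. \<forall>\<^sub>F r in sequentially. Ir r (toC iW iC u) \<in> Sor r)"

definition cond_CQ ::
  "'w::real_normed_vector dual_map \<Rightarrow> 'w dual_map \<Rightarrow>
   (nat \<Rightarrow> 'w set) \<Rightarrow> (nat \<Rightarrow> 'w set) \<Rightarrow> bool" where
  "cond_CQ A G Wr Sor \<longleftrightarrow>
     (\<forall>r\<ge>1.
        (\<forall>u\<in>Sor r. \<forall>v\<in>Scl Wr Sor r - {0}. blinfun_apply (G u) v > 0) \<and>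
        (\<forall>v\<in>Wr r. C1_on_within (\<lambda>u. blinfun_apply (A u) v) (Sor r) (Wr r) \<and>
                  C1_on_within (\<lambda>u. blinfun_apply (G u) v) (Sor r) (Wr r)))"

definition cond_CD ::
  "'w::real_normed_vector dual_map \<Rightarrow> 'w dual_map \<Rightarrow> 'w set \<Rightarrow> 'w set \<Rightarrow>
   (nat \<Rightarrow> 'w set) \<Rightarrow> (nat \<Rightarrow> 'w set) \<Rightarrow> bool" where
  "cond_CD A G Uo S Wr Sor \<longleftrightarrow>
     (\<forall>u\<in>Uo. \<forall>v\<in>S. \<forall>\<xi> l. \<forall>rs us vs \<xi>s ls.
        (\<forall>n. rs n \<ge> 1 \<and> us n \<in> Sor (rs n) \<and> vs n \<in> Sor (rs n) \<and> \<xi>s n \<in> Wr (rs n)) \<longrightarrow>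
        filterlim rs at_top sequentially \<longrightarrow> ls \<longlonglongrightarrow> l \<longrightarrow> us \<longlonglongrightarrow> u \<longrightarrow> \<xi>s \<longlonglongrightarrow> \<xi> \<longrightarrow>
        weakly_tendsto vs v \<longrightarrow>
        (\<lambda>n. dir_deriv (\<lambda>w. blinfun_apply (Fop A G w (ls n)) (vs n)) (us n) (\<xi>s n))
          \<longlonglongrightarrow> blinfun_apply (DuF A G u l \<xi>) v)"

definition cond_H ::
  "'w::real_normed_vector dual_map \<Rightarrow> 'w dual_map \<Rightarrow>
   (nat \<Rightarrow> 'w set) \<Rightarrow> (nat \<Rightarrow> 'w set) \<Rightarrow> bool" where
  "cond_H A G Wr Sor \<longleftrightarrow>
     (\<forall>\<^sub>F r in sequentially.
        (lam_star A G (Sor r) (Scl Wr Sor r) < \<infinity> \<longrightarrow>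
           (\<exists>\<alpha>::real. ereal \<alpha> < lam_star A G (Sor r) (Scl Wr Sor r) \<and>
              (let K = {u \<in> Sor r. lam A G (Scl Wr Sor r) u \<ge> ereal \<alpha>} in
                 compact (top_of_set (Wr r) closure_of K) \<and>
                 top_of_set (Wr r) closure_of K \<subseteq> Sor r))) \<and>
        (\<forall>u\<in>Sor r. \<forall>v\<in>Scl Wr Sor r - {0}.
           ereal (Rq A G u v) = lam_star A G (Sor r) (Scl Wr Sor r) \<longrightarrow>
           lam_star A G (Sor r) (Scl Wr Sor r) < \<infinity> \<longrightarrow>
           (\<forall>\<xi>\<in>Wr r. dir_deriv (\<lambda>w. Rq A G w v) u \<xi> = 0) \<longrightarrow>
           v \<in> Sor r))"

definition cond_LC ::
  "('w::real_normed_vector \<Rightarrow> 'x) \<Rightarrow> ('c \<Rightarrow> 'x) \<Rightarrow> 'w dual_map \<Rightarrow> 'w dual_map \<Rightarrow>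
   'w set \<Rightarrow> 'w set \<Rightarrow> (nat \<Rightarrow> 'w set) \<Rightarrow> (nat \<Rightarrow> 'w set) \<Rightarrow> (nat \<Rightarrow> 'c \<Rightarrow> 'w) \<Rightarrow> bool" where
  "cond_LC iW iC A G Uo S Wr Sor Ir \<longleftrightarrow>
     lam_star A G Uo S < \<infinity> \<and>
     (\<exists>\<delta>::real. \<delta> > 0 \<and>
        (\<forall>u\<in>Uo. lam A G S u \<ge> lam_star A G Uo S - ereal \<delta> \<longrightarrow>
           liminf (\<lambda>r. lam A G (Scl Wr Sor r) (Ir r (toC iW iC u))) \<ge> lam A G S u))"

definition PS_e ::
  "'w::real_normed_vector dual_map \<Rightarrow> 'w dual_map \<Rightarrow> 'w set \<Rightarrow> 'w set \<Rightarrow>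
   (nat \<Rightarrow> 'w set) \<Rightarrow> (nat \<Rightarrow> 'w set) \<Rightarrow> real \<Rightarrow> bool" where
  "PS_e A G So S Wr Sor l \<longleftrightarrow>
     (\<forall>rs us vs.
        (\<forall>n. rs n \<ge> 1 \<and> us n \<in> Sor (rs n) \<and> vs n \<in> Sor (rs n)) \<longrightarrow>
        filterlim rs at_top sequentially \<longrightarrow>
        (\<lambda>n. Rq A G (us n) (vs n)) \<longlonglongrightarrow> l \<longrightarrow>
        (\<forall>n. \<forall>\<xi>\<in>Wr (rs n). dir_deriv (\<lambda>w. Rq A G w (vs n)) (us n) \<xi> = 0) \<longrightarrow>
        (\<forall>n. \<forall>\<zeta>\<in>Wr (rs n). dir_deriv (\<lambda>w. Rq A G (us n) w) (vs n) \<zeta> = 0) \<longrightarrow>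
        (\<exists>\<phi> t. strict_mono (\<phi> :: nat \<Rightarrow> nat) \<and> (\<forall>n. t n > 0) \<and>
           (\<exists>u\<in>So. \<exists>v\<in>S - {0}.
              (\<lambda>n. us (\<phi> n)) \<longlonglongrightarrow> u \<and> weakly_tendsto (\<lambda>n. t n *\<^sub>R vs (\<phi> n)) v)))"

end

theory Submission
  imports Defs
begin

text \<open>At level \<open>r\<close>, the infimum \<open>\<lambda>\<^sub>r(u)\<close> is a minimum over the finitely many basis vectors that
  generate the cone. At a maximiser \<open>u\<close>, Gordan's alternative applied to the derivatives of
  the active constraints yields nonnegative multipliers, that is, a vector \<open>v\<close> of the closed
  cone with \<open>D\<^sub>u\<R>(u, v) = 0\<close>. By (h2) it is interior, so complementary slackness makes every
  constraint active and \<open>u\<close> solves the Galerkin equation. The \<open>(PS)\<^sub>e\<close>-condition yields limits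
  of these pairs. The level of a solution in the cone is the value of \<open>\<lambda>\<close> there, so each limit
  level is at most \<open>\<lambda>\<^sup>*\<close>, while (LC) gives the opposite inequality.\<close>

section \<open>Gordan's alternative and preliminaries\<close>

text \<open>Induction on the index set with \<open>V\<close> arbitrary, because the step uses the
  hypothesis both on \<open>V\<close> and on the kernel of the new functional \<open>L k\<close> in
  \<open>V\<close>. A direction found in the kernel is tilted slightly towards a vector where
  \<open>L k\<close> is positive. Weights found on the kernel extend to \<open>V\<close> with
  coefficient \<open>- d\<close> at \<open>k\<close>, and the sign of \<open>d\<close> decides how
  to go on.\<close>

lemma gordan_alternative:
  fixes L :: "'i \<Rightarrow> 'a::real_vector \<Rightarrow> real"
  assumes "finite I" "subspace V" "\<And>i. i \<in> I \<Longrightarrow> linear (L i)"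
  shows "(\<exists>x\<in>V. \<forall>i\<in>I. 0 < L i x) \<or>
         (\<exists>w. (\<forall>i\<in>I. 0 \<le> w i) \<and> (\<exists>i\<in>I. 0 < w i) \<and> (\<forall>x\<in>V. (\<Sum>i\<in>I. w i * L i x) = 0))"
  using assms
proof (induction I arbitrary: V rule: finite_induct)
  case empty
  then show ?case using subspace_0 by auto
next
  case (insert k J)
  have lin: "linear (L i)" if "i \<in> insert k J" for i using insert.prems(2) that by blast
  \<comment> \<open>Completes a relation whose weights on \<open>J\<close> are nonnegative and not
    all zero by a coefficient \<open>d \<ge> 0\<close> at \<open>k\<close>; overwriting
    \<open>w\<close> at \<open>k\<close> leaves the sum over \<open>J\<close> unchanged because
    \<open>k\<close> is not in \<open>J\<close>.\<close>
  have extend: ?case if w: "\<forall>i\<in>J. 0 \<le> w i" "\<exists>i\<in>J. 0 < w i" "d \<ge> 0"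
      "\<forall>x\<in>V. (\<Sum>i\<in>J. w i * L i x) + d * L k x = 0" for w :: "'i \<Rightarrow> real" and d
  proof (rule disjI2, rule exI[of _ "w(k := d)"], intro conjI ballI)
    fix x assume "x \<in> V"
    have "(\<Sum>i\<in>J. (w(k := d)) i * L i x) = (\<Sum>i\<in>J. w i * L i x)"
      using insert.hyps(2) by (intro sum.cong) auto
    then show "(\<Sum>i\<in>insert k J. (w(k := d)) i * L i x) = 0"
      using w(4) \<open>x \<in> V\<close> insert.hyps by (simp add: add.commute)
  qed (use w insert.hyps(2) in auto)
  show ?case
  proof (cases "\<forall>x\<in>V. L k x = 0")
    case True
    have "(\<Sum>i\<in>J. (if i = k then 1 else 0) * L i x) = 0" for x
      using insert.hyps(2) by (intro sum.neutral) auto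
    then have "\<forall>x\<in>V. (\<Sum>i\<in>insert k J. (if i = k then 1 else 0) * L i x) = 0"
      using True insert.hyps by simp
    then show ?thesis
      by (intro disjI2 exI[of _ "\<lambda>i. if i = k then 1 else 0"]) auto
  next
    case False
    then obtain e0 where e0: "e0 \<in> V" "L k e0 \<noteq> 0" by blast
    \<comment> \<open>Normalised so that \<open>x - L k x *\<^sub>R e\<close> is the projection of
      \<open>x\<close> along \<open>e\<close> to the kernel of \<open>L k\<close>.\<close>
    define e where "e = (1 / L k e0) *\<^sub>R e0"
    have e: "e \<in> V" "L k e = 1"
      using e0 insert.prems(1) lin[of k] by (auto simp: e_def subspace_mul linear_cmul)
    let ?V' = "{x\<in>V. L k x = 0}"
    have sub': "subspace ?V'"
      using insert.prems(1) lin[of k]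
      by (auto simp: subspace_def linear_0 linear_add linear_cmul)
    have decomp: "x - L k x *\<^sub>R e \<in> ?V'" if "x \<in> V" for x
      using that e insert.prems(1) lin[of k]
      by (auto simp: subspace_diff subspace_mul linear_diff linear_cmul)
    from insert.IH[OF sub' lin] consider
        (dir) x where "x \<in> ?V'" "\<forall>i\<in>J. 0 < L i x"
      | (weights) w where "\<forall>i\<in>J. 0 \<le> w i" "\<exists>i\<in>J. 0 < w i" "\<forall>x\<in>?V'. (\<Sum>i\<in>J. w i * L i x) = 0"
      by blast
    then show ?thesis
    proof cases
      case dir
      \<comment> \<open>For small positive \<open>t\<close> the finitely many strict inequalities
        survive the tilt, while \<open>L k\<close> takes the value \<open>t\<close>.\<close>
      have "\<forall>\<^sub>F t in at_right (0::real). 0 < L i (x + t *\<^sub>R e)" if "i \<in> J" for i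
      proof (rule order_tendstoD(1))
        have "((\<lambda>t. L i x + t * L i e) \<longlongrightarrow> L i x + 0 * L i e) (at_right 0)"
          by (intro tendsto_intros)
        then show "((\<lambda>t. L i (x + t *\<^sub>R e)) \<longlongrightarrow> L i x) (at_right 0)"
          using lin[of i] that by (simp add: linear_add linear_cmul)
        show "0 < L i x" using dir that by blast
      qed
      then have "\<forall>\<^sub>F t in at_right (0::real). \<forall>i\<in>J. 0 < L i (x + t *\<^sub>R e)"
        using insert.hyps(1) by (simp add: eventually_ball_finite_distrib)
      moreover have "\<forall>\<^sub>F t in at_right (0::real). 0 < t"
        by (simp add: eventually_at_right_less)
      ultimately have "\<forall>\<^sub>F t in at_right (0::real). 0 < t \<and> (\<forall>i\<in>J. 0 < L i (x + t *\<^sub>R e))"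
        by eventually_elim simp
      from eventually_happens'[OF trivial_limit_at_right_real this]
      obtain t :: real where t: "0 < t" "\<forall>i\<in>J. 0 < L i (x + t *\<^sub>R e)"
        by blast
      have "L k (x + t *\<^sub>R e) = t" using dir(1) e lin[of k] by (simp add: linear_add linear_cmul)
      moreover have "x + t *\<^sub>R e \<in> V"
        using dir(1) e insert.prems(1) by (simp add: subspace_add subspace_mul)
      ultimately have "\<exists>x\<in>V. \<forall>i\<in>insert k J. 0 < L i x" using t by (metis insertE)
      then show ?thesis by blast
    next
      case weights
      define d where "d = (\<Sum>i\<in>J. w i * L i e)"
      \<comment> \<open>Applying the kernel relation to the projection of \<open>x\<close> shows
        that on \<open>V\<close> it holds up to a multiple of \<open>L k\<close>.\<close>
      have comb: "(\<Sum>i\<in>J. w i * L i x) = d * L k x" if "x \<in> V" for x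
      proof -
        have "(\<Sum>i\<in>J. w i * L i (x - L k x *\<^sub>R e)) = 0" using weights(3) decomp[OF that] by blast
        moreover have "(\<Sum>i\<in>J. w i * L i (x - L k x *\<^sub>R e)) =
            (\<Sum>i\<in>J. w i * L i x - w i * L i e * L k x)"
          using lin by (intro sum.cong) (auto simp: linear_diff linear_cmul algebra_simps)
        ultimately show ?thesis by (simp add: d_def sum_subtractf sum_distrib_right)
      qed
      show ?thesis
      proof (cases "d \<le> 0")
        case True
        then show ?thesis using extend[of w "- d"] weights comb by simp
      next
        case False
        \<comment> \<open>Now \<open>d > 0\<close>, so by \<open>comb\<close> a vector of
          \<open>V\<close> on which all functionals of \<open>J\<close> are positive has
          \<open>L k\<close> positive as well. The hypothesis on \<open>V\<close> itself therefore
          settles both outcomes.\<close>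
        from insert.IH[OF insert.prems(1) lin] consider
            (dir') x where "x \<in> V" "\<forall>i\<in>J. 0 < L i x"
          | (weights') w' where "\<forall>i\<in>J. 0 \<le> w' i" "\<exists>i\<in>J. 0 < w' i"
              "\<forall>x\<in>V. (\<Sum>i\<in>J. w' i * L i x) = 0"
          by blast
        then show ?thesis
        proof cases
          case dir'
          obtain j where j: "j \<in> J" "0 < w j" using weights(2) by blast
          have "0 < (\<Sum>i\<in>J. w i * L i x)"
            using weights(1) dir' j insert.hyps(1)
            by (intro sum_pos2[of _ j]) (auto intro: mult_nonneg_nonneg less_imp_le)
          then have "0 < L k x"
            using comb[OF dir'(1)] False by (simp add: zero_less_mult_iff)
          then show ?thesis using dir' by auto
        next
          case weights'
          then show ?thesis using extend[of w' 0] by simp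
        qed
      qed
    qed
  qed
qed

section \<open>Line derivatives, levels of solutions and a convergence criterion\<close>

text \<open>Passes from a derivative relative to the subspace to the one-variable derivative behind
  \<open>dir_deriv\<close>: the line through \<open>u\<close> never leaves \<open>X\<close>, so the
  relative derivative restricts to its range.\<close>

lemma has_derivative_along_line:
  fixes f :: "'a::real_normed_vector \<Rightarrow> real"
  assumes "(f has_derivative D) (at u within X)" "subspace X" "u \<in> X" "\<xi> \<in> X"
  shows "((\<lambda>t. f (u + t *\<^sub>R \<xi>)) has_real_derivative D \<xi>) (at 0)"
proof -
  let ?g = "\<lambda>t::real. u + t *\<^sub>R \<xi>"
  have g: "(?g has_derivative (\<lambda>t. t *\<^sub>R \<xi>)) (at 0)"
    by (auto intro!: derivative_eq_intros)
  have "?g t \<in> X" for t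
    using assms(2-) by (simp add: subspace_add subspace_mul)
  then have "range ?g \<subseteq> X" by blast
  then have "(f has_derivative D) (at (?g 0) within range ?g)"
    using has_derivative_subset[OF assms(1)] by simp
  from has_derivative_in_compose[OF g this]
  have "((\<lambda>t. f (?g t)) has_derivative (\<lambda>t. D (t *\<^sub>R \<xi>))) (at 0)" by simp
  moreover have "D (t *\<^sub>R \<xi>) = t * D \<xi>" for t
    using has_derivative_linear[OF assms(1)] by (simp add: linear_cmul)
  moreover have "(\<lambda>t. t * D \<xi>) = (*) (D \<xi>)" by (simp add: fun_eq_iff)
  ultimately show ?thesis by (simp add: has_field_derivative_def)
qed

lemma Fop_apply: "blinfun_apply (Fop A G u l) v = A u v - l * G u v"
  by (simp add: Fop_def minus_blinfun.rep_eq scaleR_blinfun.rep_eq)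

text \<open>At a solution the quotient \<open>Rq A G u\<close> is constant on
  \<open>S - {0}\<close>. Nonemptiness matters, as the infimum over the empty set is
  \<infinity>.\<close>

lemma lam_solution:
  assumes "Fop A G u l = 0" "\<And>v. v \<in> S - {0} \<Longrightarrow> 0 < blinfun_apply (G u) v" "S - {0} \<noteq> {}"
  shows "lam A G S u = ereal l"
proof -
  have "Rq A G u v = l" if "v \<in> S - {0}" for v
    using Fop_apply[of A G u l v] assms(1) assms(2)[OF that] by (simp add: Rq_def field_simps)
  then have "lam A G S u = (INF v\<in>S - {0}. ereal l)" unfolding lam_def by (intro INF_cong) auto
  then show ?thesis using assms(3) by simp
qed

lemma lam_le_lam_star: "u \<in> U \<Longrightarrow> lam A G S u \<le> lam_star A G U S"
  unfolding lam_star_def by (rule SUP_upper)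

text \<open>Otherwise infinitely many terms lie in the compact interval at distance at least
  \<open>e\<close> from \<open>l\<close>, and a convergent subsequence of them contradicts
  \<open>limits\<close>.\<close>

lemma real_tendsto_by_subseq_limits:
  fixes x :: "nat \<Rightarrow> real"
  assumes "\<forall>\<^sub>F n in sequentially. x n \<in> {a..b}"
    and limits: "\<And>\<phi> \<mu>. strict_mono \<phi> \<Longrightarrow> (x \<circ> \<phi>) \<longlonglongrightarrow> \<mu> \<Longrightarrow> \<mu> = l"
  shows "x \<longlonglongrightarrow> l"
proof (rule ccontr)
  assume "\<not> x \<longlonglongrightarrow> l"
  then obtain e where e: "0 < e" "\<not> (\<forall>\<^sub>F n in sequentially. dist (x n) l < e)"
    unfolding tendsto_iff by blast
  have "\<exists>\<^sub>F n in sequentially. \<not> dist (x n) l < e"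
    using e(2) by (simp add: frequently_def)
  then have "\<exists>\<^sub>F n in sequentially. \<not> dist (x n) l < e \<and> x n \<in> {a..b}"
    using assms(1) by (rule frequently_eventually_frequently)
  then have "infinite {n. \<not> dist (x n) l < e \<and> x n \<in> {a..b}}"
    unfolding cofinite_eq_sequentially[symmetric] frequently_cofinite .
  from infinite_enumerate[OF this] obtain \<phi> :: "nat \<Rightarrow> nat" where \<phi>: "strict_mono \<phi>"
      "\<And>n. x (\<phi> n) \<in> {a..b}" "\<And>n. \<not> dist (x (\<phi> n)) l < e"
    by blast
  have "\<forall>n. (x \<circ> \<phi>) n \<in> {a..b}" using \<phi>(2) by simp
  from seq_compactE[OF compact_imp_seq_compact[OF compact_Icc] this]
  obtain \<mu> \<psi> where \<psi>: "strict_mono (\<psi> :: nat \<Rightarrow> nat)" "((x \<circ> \<phi>) \<circ> \<psi>) \<longlonglongrightarrow> \<mu>"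
    by metis
  have "\<mu> = l"
    using limits[OF strict_mono_o[OF \<phi>(1) \<psi>(1)]] \<psi>(2) by (simp only: o_assoc)
  then have "\<forall>\<^sub>F n in sequentially. dist (((x \<circ> \<phi>) \<circ> \<psi>) n) l < e"
    using \<psi>(2) e(1) by (simp add: tendsto_iff)
  then show False using \<phi>(3) by simp
qed

section \<open>Critical pairs in a simplicial cone\<close>

text \<open>The two \<open>dir_deriv\<close> clauses have the form that \<open>PS_e\<close> asks
  for; the clauses on \<open>Fop\<close> are those carried to the limit. The last one is a genuine
  derivative statement, so that it can be multiplied by the rescaling factor of
  \<open>v\<close>.\<close>

definition galerkin_critical ::
  "'w::real_normed_vector dual_map \<Rightarrow> 'w dual_map \<Rightarrow> 'w set \<Rightarrow> 'w set \<Rightarrow> real \<Rightarrow> 'w \<Rightarrow> 'w \<Rightarrow> bool" where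
  "galerkin_critical A G X P l u v \<longleftrightarrow> u \<in> P \<and> v \<in> P \<and> Rq A G u v = l \<and>
     (\<forall>\<xi>\<in>X. dir_deriv (\<lambda>w. Rq A G w v) u \<xi> = 0) \<and>
     (\<forall>\<zeta>\<in>X. dir_deriv (\<lambda>w. Rq A G u w) v \<zeta> = 0) \<and>
     (\<forall>\<zeta>\<in>X. blinfun_apply (Fop A G u l) \<zeta> = 0) \<and>
     (\<forall>\<xi>\<in>X. ((\<lambda>t. blinfun_apply (Fop A G (u + t *\<^sub>R \<xi>) l) v) has_real_derivative 0) (at 0))"

text \<open>One fixed level of the scheme: \<open>X\<close>, \<open>P\<close>, \<open>K\<close>
  stand for \<open>Wr r\<close>, \<open>Sor r\<close>, \<open>Scl Wr Sor r\<close>. The basis is a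
  set instead of an enumerated family, so that constraints are indexed by the generators
  themselves.\<close>

locale simplicial_cone =
  fixes A G :: "'w::real_normed_vector dual_map" and B X P K :: "'w set"
  assumes finite_B: "finite B"
    and independent_B: "independent B"
    and X_def: "X = span B"
    and P_def: "P = {(\<Sum>b\<in>B. a b *\<^sub>R b) | a. \<forall>b\<in>B. 0 < a b}"
    and K_def: "K = top_of_set X closure_of P"
    and open_P: "openin (top_of_set X) P"
    and cont_A: "continuous_on UNIV A"
    and cont_G: "continuous_on UNIV G"
    and G_pos: "\<And>u v. u \<in> P \<Longrightarrow> v \<in> K - {0} \<Longrightarrow> 0 < blinfun_apply (G u) v"
    and C1_A: "\<And>v. v \<in> X \<Longrightarrow> C1_on_within (\<lambda>u. blinfun_apply (A u) v) P X"
    and C1_G: "\<And>v. v \<in> X \<Longrightarrow> C1_on_within (\<lambda>u. blinfun_apply (G u) v) P X"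
begin

section \<open>Geometry of the cone and its generators\<close>

lemma subspace_X: "subspace X" by (simp add: X_def)

lemma P_subset_X: "P \<subseteq> X" using open_P openin_imp_subset by blast

lemma closure_of_eq: "T \<subseteq> P \<Longrightarrow> top_of_set X closure_of T = X \<inter> closure T"
  using P_subset_X by (simp add: closure_of_subtopology Int_absorb1)

lemma K_eq: "K = X \<inter> closure P"
  by (simp add: K_def closure_of_eq)

text \<open>Adding 1/(n+1) to each coefficient makes it strictly positive, so the combination is a
  limit of points of \<open>P\<close>.\<close>

lemma nonneg_combination_in_K:
  assumes "\<And>b. b \<in> B \<Longrightarrow> 0 \<le> a b"
  shows "(\<Sum>b\<in>B. a b *\<^sub>R b) \<in> K"
proof -
  have "(\<Sum>b\<in>B. (a b + inverse (real (Suc n))) *\<^sub>R b) \<in> P" for n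
    unfolding P_def using assms by (fastforce intro: add_nonneg_pos)
  moreover have "(\<lambda>n. \<Sum>b\<in>B. (a b + inverse (real (Suc n))) *\<^sub>R b) \<longlonglongrightarrow> (\<Sum>b\<in>B. (a b + 0) *\<^sub>R b)"
    by (intro tendsto_intros LIMSEQ_inverse_real_of_nat)
  ultimately have "(\<Sum>b\<in>B. a b *\<^sub>R b) \<in> closure P"
    unfolding closure_sequential add_0_right
    by (intro exI[of _ "\<lambda>n. \<Sum>b\<in>B. (a b + inverse (real (Suc n))) *\<^sub>R b"]) simp
  then show ?thesis
    by (simp add: K_eq X_def span_sum span_mul span_base)
qed

lemma basis_in_K: "b \<in> B \<Longrightarrow> b \<in> K - {0}"
proof -
  assume b: "b \<in> B"
  have "(\<Sum>x\<in>B. (if x = b then 1 else 0) *\<^sub>R x) = (\<Sum>x\<in>B. if x = b then x else 0)"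
    by (intro sum.cong) auto
  then have "b \<in> K"
    using nonneg_combination_in_K[of "\<lambda>x. if x = b then 1 else 0"] b finite_B by simp
  moreover have "b \<noteq> 0" using b independent_B dependent_zero by blast
  ultimately show ?thesis by blast
qed

lemma basis_in_X: "b \<in> B \<Longrightarrow> b \<in> X" by (simp add: X_def span_base)

lemma G_basis_pos: "u \<in> P \<Longrightarrow> b \<in> B \<Longrightarrow> 0 < blinfun_apply (G u) b"
  using G_pos basis_in_K by blast

text \<open>As \<open>G u\<close> is positive on \<open>K - {0}\<close>, a lower bound
  \<open>m\<close> for the quotient at \<open>v\<close> means that \<open>Fop A G u m\<close> is
  nonnegative at \<open>v\<close>. This is linear and continuous in \<open>v\<close>, so it passes
  from the generators to \<open>P\<close> and then to the closure.\<close>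

lemma le_lam_iff:
  assumes "u \<in> P"
  shows "ereal m \<le> lam A G K u \<longleftrightarrow> (\<forall>b\<in>B. 0 \<le> blinfun_apply (Fop A G u m) b)"
proof
  assume le: "ereal m \<le> lam A G K u"
  show "\<forall>b\<in>B. 0 \<le> blinfun_apply (Fop A G u m) b"
  proof
    fix b assume b: "b \<in> B"
    have "ereal m \<le> ereal (Rq A G u b)"
      using le basis_in_K[OF b] unfolding lam_def by (meson INF_lower order_trans)
    then show "0 \<le> blinfun_apply (Fop A G u m) b"
      using G_basis_pos[OF assms b] by (simp add: Rq_def Fop_apply field_simps)
  qed
next
  assume ge: "\<forall>b\<in>B. 0 \<le> blinfun_apply (Fop A G u m) b"
  have "P \<subseteq> {v. 0 \<le> blinfun_apply (Fop A G u m) v}"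
  proof
    fix v assume "v \<in> P"
    then obtain a where a: "v = (\<Sum>b\<in>B. a b *\<^sub>R b)" "\<forall>b\<in>B. 0 < a b" unfolding P_def by blast
    have "0 \<le> (\<Sum>b\<in>B. a b * blinfun_apply (Fop A G u m) b)"
      using ge a(2) by (intro sum_nonneg) (simp add: less_imp_le)
    then show "v \<in> {v. 0 \<le> blinfun_apply (Fop A G u m) v}"
      by (simp add: a(1) blinfun.sum_right blinfun.scaleR_right)
  qed
  moreover have "closed {v. 0 \<le> blinfun_apply (Fop A G u m) v}"
    by (intro closed_Collect_le continuous_intros)
  ultimately have "closure P \<subseteq> {v. 0 \<le> blinfun_apply (Fop A G u m) v}"
    by (rule closure_minimal)
  then have "m \<le> Rq A G u v" if "v \<in> K - {0}" for v
    using G_pos[OF assms that] that by (auto simp: K_eq Rq_def Fop_apply field_simps)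
  then show "ereal m \<le> lam A G K u"
    unfolding lam_def by (intro INF_greatest) auto
qed

section \<open>Attainment of the supremum\<close>

text \<open>Direct method: a maximising sequence in the superlevel set subconverges by compactness,
  and \<open>subset\<close> keeps its limit inside the open cone.\<close>

lemma sup_attained:
  assumes l: "lam_star A G P K = ereal l"
    and \<alpha>: "\<alpha> < l"
    and T_def: "T = {u\<in>P. ereal \<alpha> \<le> lam A G K u}"
    and compact: "compact (top_of_set X closure_of T)"
    and subset: "top_of_set X closure_of T \<subseteq> P"
  obtains u where "u \<in> P" "ereal l \<le> lam A G K u"
proof -
  \<comment> \<open>The levels start at \<alpha> for \<open>n = 0\<close> and increase to
    \<open>l\<close>, so every near-maximiser chosen below lies in \<open>T\<close>.\<close>
  define m where "m n = l - (l - \<alpha>) * inverse (real (Suc n))" for n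
  have m: "\<alpha> \<le> m n" "m n < l" for n
    using \<alpha> mult_left_mono[of "inverse (real (Suc n))" 1 "l - \<alpha>"]
    by (auto simp: m_def field_simps)
  have "\<exists>u\<in>P. ereal (m n) < lam A G K u" for n
    using l m(2)[of n] less_SUP_iff[of "ereal (m n)" "lam A G K" P] by (simp add: lam_star_def)
  then obtain u where u: "\<And>n. u n \<in> P" "\<And>n. ereal (m n) < lam A G K (u n)" by metis
  have "u n \<in> T" for n
    using u(1)[of n] order_trans[of "ereal \<alpha>" "ereal (m n)" "lam A G K (u n)"] u(2)[of n] m(1)[of n]
    by (simp add: T_def)
  moreover have "T \<subseteq> top_of_set X closure_of T"
    using P_subset_X by (intro closure_of_subset) (auto simp: T_def)
  ultimately obtain z \<phi> where z: "z \<in> top_of_set X closure_of T" "strict_mono (\<phi> :: nat \<Rightarrow> nat)"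
      "(u \<circ> \<phi>) \<longlonglongrightarrow> z"
    using seq_compactE[OF compact_imp_seq_compact[OF compact], of u] by blast
  have "m \<longlonglongrightarrow> l - (l - \<alpha>) * 0"
    unfolding m_def by (intro tendsto_intros LIMSEQ_inverse_real_of_nat)
  then have m_lim: "(\<lambda>n. m (\<phi> n)) \<longlonglongrightarrow> l"
    using LIMSEQ_subseq_LIMSEQ[OF _ z(2)] by (simp add: o_def)
  have AG_lim: "(\<lambda>n. A (u (\<phi> n))) \<longlonglongrightarrow> A z" "(\<lambda>n. G (u (\<phi> n))) \<longlonglongrightarrow> G z"
    using continuous_on_tendsto_compose[OF cont_A z(3)]
      continuous_on_tendsto_compose[OF cont_G z(3)] by auto
  \<comment> \<open>By \<open>le_lam_iff\<close> the bound on \<open>lam\<close> is a family of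
    inequalities, one per generator, that are continuous jointly in the point and the level; hence
    they survive the limit.\<close>
  have "0 \<le> blinfun_apply (Fop A G z l) b" if "b \<in> B" for b
  proof (rule LIMSEQ_le_const)
    show "(\<lambda>n. blinfun_apply (Fop A G (u (\<phi> n)) (m (\<phi> n))) b) \<longlonglongrightarrow> blinfun_apply (Fop A G z l) b"
      unfolding Fop_apply by (intro tendsto_intros AG_lim m_lim)
    show "\<exists>N. \<forall>n\<ge>N. 0 \<le> blinfun_apply (Fop A G (u (\<phi> n)) (m (\<phi> n))) b"
      using le_lam_iff[OF u(1), THEN iffD1, OF less_imp_le[OF u(2)]] that by blast
  qed
  then show thesis using that z(1) subset le_lam_iff by blast
qed

section \<open>First-order optimality at a maximiser\<close>

text \<open>The parts \<open>A\<close> and \<open>G\<close> are kept apart because the quotient rule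
  for \<open>Rq\<close> needs both derivatives.\<close>

lemma Fop_line_derivative:
  assumes "u \<in> P" "v \<in> X"
  obtains DA DG :: "'w \<Rightarrow>\<^sub>L real" where
    "\<And>\<xi>. \<xi> \<in> X \<Longrightarrow> ((\<lambda>t. blinfun_apply (A (u + t *\<^sub>R \<xi>)) v) has_real_derivative DA \<xi>) (at 0)"
    "\<And>\<xi>. \<xi> \<in> X \<Longrightarrow> ((\<lambda>t. blinfun_apply (G (u + t *\<^sub>R \<xi>)) v) has_real_derivative DG \<xi>) (at 0)"
proof -
  obtain DA DG :: "'w \<Rightarrow>\<^sub>L real" where
    "((\<lambda>u. blinfun_apply (A u) v) has_derivative DA) (at u within X)"
    "((\<lambda>u. blinfun_apply (G u) v) has_derivative DG) (at u within X)"
    using C1_A[OF assms(2)] C1_G[OF assms(2)] assms(1) unfolding C1_on_within_def by blast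
  with that show thesis
    using has_derivative_along_line subspace_X assms(1) P_subset_X by blast
qed

lemma eventually_line_in_P:
  assumes "u \<in> P" "\<xi> \<in> X"
  shows "\<forall>\<^sub>F t in at_right 0. u + t *\<^sub>R \<xi> \<in> P"
proof -
  obtain O' where O': "open O'" "P = X \<inter> O'" using open_P by (auto simp: openin_open)
  have "((\<lambda>t. u + t *\<^sub>R \<xi>) \<longlongrightarrow> u + 0 *\<^sub>R \<xi>) (at_right 0)" by (intro tendsto_intros)
  then have "\<forall>\<^sub>F t in at_right 0. u + t *\<^sub>R \<xi> \<in> O'"
    using O' assms(1) by (auto intro: topological_tendstoD)
  then show ?thesis
    using O'(2) assms P_subset_X subspace_X
    by (auto elim!: eventually_mono simp: subspace_add subspace_mul subset_iff)
qed

text \<open>If every active constraint increased strictly along \<xi>, a short move would make all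
  constraints strictly positive: the active ones by their derivative, the others by continuity. The
  slack would then allow a level above the supremum.\<close>

lemma no_ascent_direction:
  assumes l: "lam_star A G P K = ereal l"
    and u: "u \<in> P" "ereal l \<le> lam A G K u"
    and \<xi>: "\<xi> \<in> X"
    and deriv: "\<And>b. b \<in> B \<Longrightarrow>
      ((\<lambda>t. blinfun_apply (Fop A G (u + t *\<^sub>R \<xi>) l) b) has_real_derivative D b) (at 0)"
  shows "\<exists>b\<in>B. blinfun_apply (Fop A G u l) b = 0 \<and> D b \<le> 0"
proof (rule ccontr)
  assume "\<not> ?thesis"
  then have up: "0 < D b" if "b \<in> B" "blinfun_apply (Fop A G u l) b = 0" for b
    using that by force
  have "\<forall>\<^sub>F t in at_right 0. 0 < blinfun_apply (Fop A G (u + t *\<^sub>R \<xi>) l) b" if b: "b \<in> B" for b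
  proof (cases "blinfun_apply (Fop A G u l) b = 0")
    case True
    obtain d where "0 < d" "\<And>h. 0 < h \<Longrightarrow> h < d \<Longrightarrow>
        blinfun_apply (Fop A G (u + 0 *\<^sub>R \<xi>) l) b < blinfun_apply (Fop A G (u + (0 + h) *\<^sub>R \<xi>) l) b"
      using DERIV_pos_inc_right[OF deriv[OF b] up[OF b True]] by blast
    then show ?thesis using True by (auto simp: eventually_at_right_field)
  next
    case False
    then have pos: "0 < blinfun_apply (Fop A G u l) b"
      using le_lam_iff[OF u(1)] u(2) b by force
    have "((\<lambda>t. blinfun_apply (Fop A G (u + t *\<^sub>R \<xi>) l) b) \<longlongrightarrow> blinfun_apply (Fop A G u l) b) (at 0)"
      using DERIV_isCont[OF deriv[OF b]] by (simp add: isCont_def)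
    then have "((\<lambda>t. blinfun_apply (Fop A G (u + t *\<^sub>R \<xi>) l) b) \<longlongrightarrow> blinfun_apply (Fop A G u l) b)
        (at_right 0)"
      by (simp add: filterlim_at_split)
    then show ?thesis using pos by (rule order_tendstoD(1))
  qed
  then have "\<forall>\<^sub>F t in at_right 0. \<forall>b\<in>B. 0 < blinfun_apply (Fop A G (u + t *\<^sub>R \<xi>) l) b"
    using finite_B by (simp add: eventually_ball_finite_distrib)
  then have "\<forall>\<^sub>F t in at_right 0. u + t *\<^sub>R \<xi> \<in> P \<and>
      (\<forall>b\<in>B. 0 < blinfun_apply (Fop A G (u + t *\<^sub>R \<xi>) l) b)"
    using eventually_line_in_P[OF u(1) \<xi>] by eventually_elim simp
  from eventually_happens'[OF trivial_limit_at_right_real this]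
  obtain z where z: "z \<in> P" "\<And>b. b \<in> B \<Longrightarrow> 0 < blinfun_apply (Fop A G z l) b"
    by blast
  \<comment> \<open>All constraints at \<open>z\<close> have slack, so the level can be raised from
    \<open>l\<close> to \<open>l + e\<close> for some small \<open>e > 0\<close>.\<close>
  have "\<forall>\<^sub>F e in at_right 0. 0 < blinfun_apply (Fop A G z (l + e)) b" if "b \<in> B" for b
  proof (rule order_tendstoD(1))
    have "((\<lambda>e. A z b - (l + e) * G z b) \<longlongrightarrow> A z b - (l + 0) * G z b) (at_right 0)"
      by (intro tendsto_intros)
    then show "((\<lambda>e. blinfun_apply (Fop A G z (l + e)) b) \<longlongrightarrow> blinfun_apply (Fop A G z l) b) (at_right 0)"
      by (simp add: Fop_apply)
  qed (rule z(2)[OF that])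
  then have "\<forall>\<^sub>F e in at_right 0. \<forall>b\<in>B. 0 < blinfun_apply (Fop A G z (l + e)) b"
    using finite_B by (simp add: eventually_ball_finite_distrib)
  then have "\<forall>\<^sub>F e in at_right (0::real). 0 < e \<and> (\<forall>b\<in>B. 0 < blinfun_apply (Fop A G z (l + e)) b)"
    using eventually_at_right_less[of "0::real"] by eventually_elim simp
  from eventually_happens'[OF trivial_limit_at_right_real this]
  obtain e where e: "0 < e" "\<And>b. b \<in> B \<Longrightarrow> 0 < blinfun_apply (Fop A G z (l + e)) b"
    by blast
  have "ereal (l + e) \<le> lam A G K z" using le_lam_iff[OF z(1)] e(2) by (simp add: less_imp_le)
  also have "\<dots> \<le> ereal l" using lam_le_lam_star[OF z(1), of A G K] l by simp
  finally show False using e(1) by simp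
qed

text \<open>\<open>no_ascent_direction\<close> excludes the first outcome of Gordan's alternative
  for the active constraints, and the weights of the second are the coefficients of
  \<open>v\<close>. Since only active generators enter, \<open>Fop A G u l\<close> vanishes at
  \<open>v\<close>.\<close>

lemma multiplier_exists:
  assumes l: "lam_star A G P K = ereal l"
    and u: "u \<in> P" "ereal l \<le> lam A G K u"
  obtains v where "v \<in> K - {0}" "blinfun_apply (Fop A G u l) v = 0"
    "\<And>\<xi>. \<xi> \<in> X \<Longrightarrow> ((\<lambda>t. blinfun_apply (Fop A G (u + t *\<^sub>R \<xi>) l) v) has_real_derivative 0) (at 0)"
proof -
  define I where "I = {b\<in>B. blinfun_apply (Fop A G u l) b = 0}"
  have "\<exists>L :: 'w \<Rightarrow>\<^sub>L real. \<forall>\<xi>\<in>X.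
      ((\<lambda>t. blinfun_apply (Fop A G (u + t *\<^sub>R \<xi>) l) b) has_real_derivative L \<xi>) (at 0)"
    if b: "b \<in> B" for b
  proof -
    obtain DA DG :: "'w \<Rightarrow>\<^sub>L real" where D:
      "\<And>\<xi>. \<xi> \<in> X \<Longrightarrow> ((\<lambda>t. blinfun_apply (A (u + t *\<^sub>R \<xi>)) b) has_real_derivative DA \<xi>) (at 0)"
      "\<And>\<xi>. \<xi> \<in> X \<Longrightarrow> ((\<lambda>t. blinfun_apply (G (u + t *\<^sub>R \<xi>)) b) has_real_derivative DG \<xi>) (at 0)"
      using Fop_line_derivative[OF u(1) basis_in_X[OF b]] by metis
    show ?thesis
      by (rule exI[of _ "DA - l *\<^sub>R DG"])
        (auto simp: Fop_apply minus_blinfun.rep_eq scaleR_blinfun.rep_eq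
          intro!: derivative_eq_intros D)
  qed
  then obtain L :: "'w \<Rightarrow> 'w \<Rightarrow>\<^sub>L real" where L: "\<And>b \<xi>. b \<in> B \<Longrightarrow> \<xi> \<in> X \<Longrightarrow>
      ((\<lambda>t. blinfun_apply (Fop A G (u + t *\<^sub>R \<xi>) l) b) has_real_derivative L b \<xi>) (at 0)"
    by metis
  have "\<not> (\<exists>\<xi>\<in>X. \<forall>b\<in>I. 0 < L b \<xi>)"
  proof
    assume "\<exists>\<xi>\<in>X. \<forall>b\<in>I. 0 < L b \<xi>"
    then obtain \<xi> where \<xi>: "\<xi> \<in> X" "\<forall>b\<in>I. 0 < L b \<xi>" by blast
    show False
      using no_ascent_direction[OF l u \<xi>(1) L[OF _ \<xi>(1)]] \<xi>(2) by (force simp: I_def)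
  qed
  moreover have "finite I" using finite_B by (simp add: I_def)
  ultimately obtain w where w: "\<forall>b\<in>I. 0 \<le> w b" "\<exists>b\<in>I. 0 < w b"
      "\<forall>\<xi>\<in>X. (\<Sum>b\<in>I. w b * L b \<xi>) = 0"
    using gordan_alternative[of I X "\<lambda>b. blinfun_apply (L b)"] subspace_X
    by (auto simp: blinfun.bounded_linear_right bounded_linear.linear)
  define v where "v = (\<Sum>b\<in>I. w b *\<^sub>R b)"
  have "v = (\<Sum>b\<in>B. (if b \<in> I then w b else 0) *\<^sub>R b)"
    unfolding v_def using finite_B by (intro sum.mono_neutral_cong_left) (auto simp: I_def)
  then have "v \<in> K"
    using nonneg_combination_in_K[of "\<lambda>b. if b \<in> I then w b else 0"] w(1) by simp
  \<comment> \<open>Pairing with \<open>G u\<close> detects this: it is positive on every generator,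
    and at least one weight is positive.\<close>
  moreover have "v \<noteq> 0"
  proof
    assume "v = 0"
    obtain b where b: "b \<in> I" "0 < w b" using w(2) by blast
    have "0 < (\<Sum>b\<in>I. w b * G u b)"
      using b w(1) G_basis_pos[OF u(1)] \<open>finite I\<close>
      by (intro sum_pos2[of _ b]) (simp_all add: I_def less_imp_le)
    also have "\<dots> = blinfun_apply (G u) v"
      by (simp add: v_def blinfun.sum_right blinfun.scaleR_right)
    finally show False using \<open>v = 0\<close> by (simp add: blinfun.zero_right)
  qed
  moreover have Fv: "blinfun_apply (Fop A G z l) v = (\<Sum>b\<in>I. w b * blinfun_apply (Fop A G z l) b)" for z
    by (simp add: v_def blinfun.sum_right blinfun.scaleR_right)
  moreover have "blinfun_apply (Fop A G u l) v = 0"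
    unfolding Fv by (auto simp: I_def intro: sum.neutral)
  moreover have "((\<lambda>t. blinfun_apply (Fop A G (u + t *\<^sub>R \<xi>) l) v) has_real_derivative 0) (at 0)"
    if "\<xi> \<in> X" for \<xi>
  proof -
    have "((\<lambda>t. \<Sum>b\<in>I. w b * blinfun_apply (Fop A G (u + t *\<^sub>R \<xi>) l) b)
        has_real_derivative (\<Sum>b\<in>I. w b * L b \<xi>)) (at 0)"
      using L that by (intro DERIV_sum DERIV_cmult) (auto simp: I_def)
    then show ?thesis using w(3) that by (simp add: Fv)
  qed
  ultimately show thesis using that by blast
qed

text \<open>Since \<open>A u v = l * G u v\<close>, the numerator in the quotient rule is
  \<open>G u v\<close> times the derivative of \<open>Fop\<close> at level \<open>l\<close>, which
  is zero.\<close>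

lemma dir_deriv_Rq_zero:
  assumes u: "u \<in> P" and v: "v \<in> K - {0}" and F0: "blinfun_apply (Fop A G u l) v = 0"
    and \<xi>: "\<xi> \<in> X"
    and D0: "((\<lambda>t. blinfun_apply (Fop A G (u + t *\<^sub>R \<xi>) l) v) has_real_derivative 0) (at 0)"
  shows "dir_deriv (\<lambda>w. Rq A G w v) u \<xi> = 0"
proof -
  have "v \<in> X" using v by (simp add: K_eq)
  obtain DA DG :: "'w \<Rightarrow>\<^sub>L real" where D:
    "((\<lambda>t. blinfun_apply (A (u + t *\<^sub>R \<xi>)) v) has_real_derivative DA \<xi>) (at 0)"
    "((\<lambda>t. blinfun_apply (G (u + t *\<^sub>R \<xi>)) v) has_real_derivative DG \<xi>) (at 0)"
    using Fop_line_derivative[OF u \<open>v \<in> X\<close>] \<xi> by metis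
  have "((\<lambda>t. blinfun_apply (Fop A G (u + t *\<^sub>R \<xi>) l) v) has_real_derivative DA \<xi> - l * DG \<xi>) (at 0)"
    unfolding Fop_apply by (auto intro!: derivative_eq_intros D)
  then have DA: "DA \<xi> = l * DG \<xi>" using DERIV_unique[OF D0] by force
  have Au: "A u v = l * G u v" using F0 by (simp add: Fop_apply)
  have "((\<lambda>t. Rq A G (u + t *\<^sub>R \<xi>) v) has_real_derivative
      (DA \<xi> * G u v - A u v * DG \<xi>) / (G u v * G u v)) (at 0)"
    unfolding Rq_def using DERIV_divide[OF D] G_pos[OF u v] by simp
  then show ?thesis
    unfolding dir_deriv_def by (intro DERIV_imp_deriv) (simp add: DA Au)
qed

lemma critical_pair_exists:
  assumes l: "lam_star A G P K = ereal l"
    and h1: "\<exists>\<alpha>. ereal \<alpha> < lam_star A G P K \<and>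
      (let T = {u \<in> P. lam A G K u \<ge> ereal \<alpha>} in
        compact (top_of_set X closure_of T) \<and> top_of_set X closure_of T \<subseteq> P)"
    and h2: "\<And>u v. u \<in> P \<Longrightarrow> v \<in> K - {0} \<Longrightarrow> Rq A G u v = l \<Longrightarrow>
      (\<forall>\<xi>\<in>X. dir_deriv (\<lambda>w. Rq A G w v) u \<xi> = 0) \<Longrightarrow> v \<in> P"
  shows "\<exists>u v. galerkin_critical A G X P l u v"
proof -
  obtain u where u: "u \<in> P" "ereal l \<le> lam A G K u"
    using h1 sup_attained[OF l] l by (auto simp: Let_def)
  obtain v where v: "v \<in> K - {0}" and Fv: "blinfun_apply (Fop A G u l) v = 0"
    and Dv: "\<And>\<xi>. \<xi> \<in> X \<Longrightarrow>
      ((\<lambda>t. blinfun_apply (Fop A G (u + t *\<^sub>R \<xi>) l) v) has_real_derivative 0) (at 0)"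
    using multiplier_exists[OF l u] by metis
  have Rv: "Rq A G u v = l" using Fv G_pos[OF u(1) v] by (simp add: Fop_apply Rq_def)
  have Du: "dir_deriv (\<lambda>w. Rq A G w v) u \<xi> = 0" if "\<xi> \<in> X" for \<xi>
    using dir_deriv_Rq_zero[OF u(1) v Fv that Dv[OF that]] .
  \<comment> \<open>Interiority gives \<open>v\<close> strictly positive coefficients; the
    nonnegative terms of \<open>Fop A G u l\<close> at \<open>v\<close> sum to zero, so every
    constraint is active.\<close>
  have vP: "v \<in> P" using h2 u(1) v Rv Du by blast
  then obtain a where a: "v = (\<Sum>b\<in>B. a b *\<^sub>R b)" "\<forall>b\<in>B. 0 < a b" unfolding P_def by blast
  have nonneg: "0 \<le> blinfun_apply (Fop A G u l) b" if "b \<in> B" for b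
    using le_lam_iff[OF u(1)] u(2) that by blast
  have "(\<Sum>b\<in>B. a b * blinfun_apply (Fop A G u l) b) = 0"
    using Fv by (simp add: a(1) blinfun.sum_right blinfun.scaleR_right)
  then have "\<forall>b\<in>B. a b * blinfun_apply (Fop A G u l) b = 0"
    using a(2) nonneg finite_B by (subst (asm) sum_nonneg_eq_0_iff) (simp_all add: less_imp_le)
  then have Fb: "blinfun_apply (Fop A G u l) b = 0" if "b \<in> B" for b
    using a(2) that by force
  have F0: "blinfun_apply (Fop A G u l) \<zeta> = 0" if "\<zeta> \<in> X" for \<zeta>
    using linear_eq_0_on_span[of "blinfun_apply (Fop A G u l)" B \<zeta>] Fb that
    by (simp add: X_def blinfun.bounded_linear_right bounded_linear.linear)
  \<comment> \<open>On \<open>X\<close> the functional \<open>A u\<close> equals \<open>l\<close>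
    times \<open>G u\<close>, so the quotient is constant in its second argument near
    \<open>v\<close>.\<close>
  have "dir_deriv (\<lambda>w. Rq A G u w) v \<zeta> = 0" if \<zeta>: "\<zeta> \<in> X" for \<zeta>
  proof -
    have Gv: "G u v \<noteq> 0" using G_pos[OF u(1) v] by simp
    have AG: "A u v = l * G u v" "A u \<zeta> = l * G u \<zeta>" using Fv F0[OF \<zeta>] by (auto simp: Fop_apply)
    have "((\<lambda>t. (A u v + t * A u \<zeta>) / (G u v + t * G u \<zeta>)) has_real_derivative 0) (at 0)"
      using Gv by (auto intro!: derivative_eq_intros simp: AG)
    then have "((\<lambda>t. Rq A G u (v + t *\<^sub>R \<zeta>)) has_real_derivative 0) (at 0)"
      by (simp add: Rq_def blinfun.add_right blinfun.scaleR_right)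
    then show ?thesis unfolding dir_deriv_def by (rule DERIV_imp_deriv)
  qed
  then have "galerkin_critical A G X P l u v"
    unfolding galerkin_critical_def using u(1) vP Rv Du F0 Dv by blast
  then show ?thesis by blast
qed

end

section \<open>Passage to the limit\<close>

lemma galerkin_critical_pair:
  assumes r: "1 \<le> r"
    and cont: "continuous_on UNIV A" "continuous_on UNIV G"
    and C: "cond_C iW iC Uo S Wr N Sor Ir"
    and CQ: "cond_CQ A G Wr Sor"
    and l: "lam_star A G (Sor r) (Scl Wr Sor r) = ereal l"
    and h1: "\<exists>\<alpha>::real. ereal \<alpha> < lam_star A G (Sor r) (Scl Wr Sor r) \<and>
      (let K = {u \<in> Sor r. lam A G (Scl Wr Sor r) u \<ge> ereal \<alpha>} in
        compact (top_of_set (Wr r) closure_of K) \<and> top_of_set (Wr r) closure_of K \<subseteq> Sor r)"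
    and h2: "\<And>u v. u \<in> Sor r \<Longrightarrow> v \<in> Scl Wr Sor r - {0} \<Longrightarrow> Rq A G u v = l \<Longrightarrow>
      (\<forall>\<xi>\<in>Wr r. dir_deriv (\<lambda>w. Rq A G w v) u \<xi> = 0) \<Longrightarrow> v \<in> Sor r"
  shows "\<exists>u v. galerkin_critical A G (Wr r) (Sor r) l u v"
proof -
  obtain \<eta> :: "nat \<Rightarrow> 'a" where \<eta>: "inj_on \<eta> {1..N r}" "independent (\<eta> ` {1..N r})"
      "span (\<eta> ` {1..N r}) = Wr r"
      "Sor r = {(\<Sum>i=1..N r. a i *\<^sub>R \<eta> i) | a. \<forall>i\<in>{1..N r}. a i > 0}"
    using C[unfolded cond_C_def, THEN conjunct2, THEN conjunct1, rule_format, OF r]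
    by (elim exE conjE) (rule that)
  \<comment> \<open>Coefficients are reindexed from numbers to basis vectors through the injective
    enumeration \<eta>, as the locale expects.\<close>
  have Sor_eq: "Sor r = {(\<Sum>b\<in>\<eta> ` {1..N r}. a b *\<^sub>R b) | a. \<forall>b\<in>\<eta> ` {1..N r}. 0 < a b}"
  proof (intro equalityI subsetI)
    fix u assume "u \<in> Sor r"
    then obtain a where a: "u = (\<Sum>i=1..N r. a i *\<^sub>R \<eta> i)" "\<forall>i\<in>{1..N r}. a i > 0"
      unfolding \<eta>(4) by blast
    let ?a = "a \<circ> the_inv_into {1..N r} \<eta>"
    have "u = (\<Sum>b\<in>\<eta> ` {1..N r}. ?a b *\<^sub>R b)"
      unfolding a(1) sum.reindex[OF \<eta>(1)]
      using the_inv_into_f_f[OF \<eta>(1)] by (intro sum.cong refl) (simp del: One_nat_def)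
    moreover have "\<forall>b\<in>\<eta> ` {1..N r}. 0 < ?a b"
      using a(2) the_inv_into_f_f[OF \<eta>(1)] by simp
    ultimately show "u \<in> {(\<Sum>b\<in>\<eta> ` {1..N r}. a b *\<^sub>R b) | a. \<forall>b\<in>\<eta> ` {1..N r}. 0 < a b}"
      by blast
  next
    fix u assume "u \<in> {(\<Sum>b\<in>\<eta> ` {1..N r}. a b *\<^sub>R b) | a. \<forall>b\<in>\<eta> ` {1..N r}. 0 < a b}"
    then obtain a where a: "u = (\<Sum>b\<in>\<eta> ` {1..N r}. a b *\<^sub>R b)" "\<forall>b\<in>\<eta> ` {1..N r}. 0 < a b"
      by blast
    then have "u = (\<Sum>i=1..N r. (a \<circ> \<eta>) i *\<^sub>R \<eta> i)" "\<forall>i\<in>{1..N r}. 0 < (a \<circ> \<eta>) i"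
      by (simp_all add: sum.reindex[OF \<eta>(1)] del: One_nat_def)
    then show "u \<in> Sor r" unfolding \<eta>(4) by blast
  qed
  note CQr = CQ[unfolded cond_CQ_def, THEN spec, THEN mp, OF r]
  interpret simplicial_cone A G "\<eta> ` {1..N r}" "Wr r" "Sor r" "Scl Wr Sor r"
  proof
    show "openin (top_of_set (Wr r)) (Sor r)"
      using C[unfolded cond_C_def, THEN conjunct1, THEN spec, THEN mp, OF r] by (elim conjE)
    show "0 < blinfun_apply (G u) v" if "u \<in> Sor r" "v \<in> Scl Wr Sor r - {0}" for u v
      using CQr that by blast
    show "C1_on_within (\<lambda>u. blinfun_apply (A u) v) (Sor r) (Wr r)"
      "C1_on_within (\<lambda>u. blinfun_apply (G u) v) (Sor r) (Wr r)" if "v \<in> Wr r" for v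
      using bspec[OF conjunct2[OF CQr] that] by simp_all
  qed (fact Sor_eq cont \<eta>(2) \<eta>(3)[symmetric] Scl_def finite_imageI[OF finite_atLeastAtMost])+
  show ?thesis by (rule critical_pair_exists[OF l h1 h2])
qed

text \<open>The discrete equations are tested with Galerkin approximations of a fixed vector.
  Continuity of \<open>A\<close> and \<open>G\<close> gives the limit equation, and (CD) gives the
  linearised one.\<close>

lemma critical_pairs_limit:
  assumes cont: "continuous_on UNIV A" "continuous_on UNIV G"
    and R: "cond_R A G So Uo"
    and dense: "\<forall>\<xi>. \<exists>x. (\<forall>r\<ge>1. x r \<in> Wr r) \<and> x \<longlonglongrightarrow> \<xi>"
    and cone: "\<forall>r\<ge>1. pos_cone (Sor r)"
    and CD: "cond_CD A G Uo S Wr Sor"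
    and PS: "PS_e A G So S Wr Sor \<mu>"
    and rs: "\<And>n. 1 \<le> rs n" "filterlim rs at_top sequentially"
    and ls: "ls \<longlonglongrightarrow> \<mu>"
    and crit: "\<And>n. galerkin_critical A G (Wr (rs n)) (Sor (rs n)) (ls n) (us n) (vs n)"
  obtains \<phi> t u v where "strict_mono (\<phi> :: nat \<Rightarrow> nat)" "\<And>n. 0 < (t n :: real)"
    "u \<in> Uo" "v \<in> S - {0}" "(\<lambda>n. us (\<phi> n)) \<longlonglongrightarrow> u"
    "weakly_tendsto (\<lambda>n. t n *\<^sub>R vs (\<phi> n)) v"
    "Fop A G u \<mu> = 0" "\<And>\<xi>. blinfun_apply (DuF A G u \<mu> \<xi>) v = 0"
proof -
  have in_cone: "us n \<in> Sor (rs n)" "vs n \<in> Sor (rs n)" for n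
    using crit[of n] by (auto simp: galerkin_critical_def)
  have Rq_lim: "(\<lambda>n. Rq A G (us n) (vs n)) \<longlonglongrightarrow> \<mu>"
    using ls crit by (simp add: galerkin_critical_def)
  have Rq_crit: "\<forall>n. \<forall>\<xi>\<in>Wr (rs n). dir_deriv (\<lambda>w. Rq A G w (vs n)) (us n) \<xi> = 0"
    "\<forall>n. \<forall>\<zeta>\<in>Wr (rs n). dir_deriv (\<lambda>w. Rq A G (us n) w) (vs n) \<zeta> = 0"
    using crit by (auto simp: galerkin_critical_def)
  have "\<forall>n. rs n \<ge> 1 \<and> us n \<in> Sor (rs n) \<and> vs n \<in> Sor (rs n)"
    using in_cone rs(1) by blast
  from PS[unfolded PS_e_def, THEN spec, THEN spec, THEN spec, THEN mp, OF this, THEN mp, OF rs(2),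
      THEN mp, OF Rq_lim, THEN mp, OF Rq_crit(1), THEN mp, OF Rq_crit(2)]
  obtain \<phi> t u v where \<phi>: "strict_mono (\<phi> :: nat \<Rightarrow> nat)" and t: "\<forall>n. t n > (0::real)"
      and uv: "u \<in> So" "v \<in> S - {0}"
      and lim: "(\<lambda>n. us (\<phi> n)) \<longlonglongrightarrow> u" "weakly_tendsto (\<lambda>n. t n *\<^sub>R vs (\<phi> n)) v"
    by blast
  have rs\<phi>: "filterlim (\<lambda>n. rs (\<phi> n)) at_top sequentially"
    using filterlim_compose[OF rs(2) filterlim_subseq[OF \<phi>]] .
  have ls\<phi>: "(\<lambda>n. ls (\<phi> n)) \<longlonglongrightarrow> \<mu>"
    using LIMSEQ_subseq_LIMSEQ[OF ls \<phi>] by (simp add: o_def)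
  \<comment> \<open>The approximants from density are reindexed along
    \<open>rs \<circ> \<phi>\<close>, so that they are admissible test vectors for the selected
    pairs.\<close>
  have approx: "\<exists>\<xi>s. (\<forall>n. \<xi>s n \<in> Wr (rs (\<phi> n))) \<and> \<xi>s \<longlonglongrightarrow> \<xi>" for \<xi>
  proof -
    obtain x where x: "\<forall>r\<ge>1. x r \<in> Wr r" "x \<longlonglongrightarrow> \<xi>" using dense by blast
    then show ?thesis
      using filterlim_compose[OF x(2) rs\<phi>] rs(1) by (intro exI[of _ "\<lambda>n. x (rs (\<phi> n))"]) auto
  qed
  have AG_lim: "(\<lambda>n. A (us (\<phi> n))) \<longlonglongrightarrow> A u" "(\<lambda>n. G (us (\<phi> n))) \<longlonglongrightarrow> G u"
    using continuous_on_tendsto_compose[OF cont(1) lim(1)]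
      continuous_on_tendsto_compose[OF cont(2) lim(1)] by auto
  have "blinfun_apply (Fop A G u \<mu>) \<zeta> = 0" for \<zeta>
  proof -
    obtain \<zeta>s where \<zeta>s: "\<And>n. \<zeta>s n \<in> Wr (rs (\<phi> n))" "\<zeta>s \<longlonglongrightarrow> \<zeta>" using approx by blast
    have "(\<lambda>n. blinfun_apply (Fop A G (us (\<phi> n)) (ls (\<phi> n))) (\<zeta>s n))
        \<longlonglongrightarrow> blinfun_apply (Fop A G u \<mu>) \<zeta>"
      unfolding Fop_apply by (intro tendsto_intros AG_lim ls\<phi> \<zeta>s(2))
    moreover have "blinfun_apply (Fop A G (us (\<phi> n)) (ls (\<phi> n))) (\<zeta>s n) = 0" for n
      using crit[of "\<phi> n"] \<zeta>s(1) by (auto simp: galerkin_critical_def)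
    ultimately show ?thesis by (simp add: LIMSEQ_const_iff)
  qed
  then have F0: "Fop A G u \<mu> = 0" by (intro blinfun_eqI) simp
  \<comment> \<open>The compactness condition places \<open>u\<close> only in \<open>So\<close>; (R)
    moves it to \<open>Uo\<close>, where (CD) applies.\<close>
  then have uUo: "u \<in> Uo" using R uv(1) unfolding cond_R_def by blast
  have "blinfun_apply (DuF A G u \<mu> \<xi>) v = 0" for \<xi>
  proof -
    obtain \<xi>s where \<xi>s: "\<And>n. \<xi>s n \<in> Wr (rs (\<phi> n))" "\<xi>s \<longlonglongrightarrow> \<xi>" using approx by blast
    \<comment> \<open>The rescaled vectors remain in the cones because these are closed under
      positive factors.\<close>
    have "\<forall>n. rs (\<phi> n) \<ge> 1 \<and> us (\<phi> n) \<in> Sor (rs (\<phi> n)) \<and> t n *\<^sub>R vs (\<phi> n) \<in> Sor (rs (\<phi> n)) \<and>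
        \<xi>s n \<in> Wr (rs (\<phi> n))"
      using rs(1) in_cone cone t \<xi>s(1) unfolding pos_cone_def by blast
    moreover have "v \<in> S" using uv(2) by blast
    ultimately have D_lim: "(\<lambda>n. dir_deriv (\<lambda>w. blinfun_apply (Fop A G w (ls (\<phi> n))) (t n *\<^sub>R vs (\<phi> n)))
        (us (\<phi> n)) (\<xi>s n)) \<longlonglongrightarrow> blinfun_apply (DuF A G u \<mu> \<xi>) v"
      using CD[unfolded cond_CD_def, THEN bspec, OF uUo, THEN bspec, THEN spec, THEN spec, THEN spec,
          THEN spec, THEN spec, THEN spec, THEN spec, THEN mp, THEN mp, OF _ _ rs\<phi>, THEN mp, OF _ _ ls\<phi>,
          THEN mp, OF _ _ lim(1), THEN mp, OF _ _ \<xi>s(2), THEN mp, OF _ _ lim(2)]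
      by blast
    have "dir_deriv (\<lambda>w. blinfun_apply (Fop A G w (ls (\<phi> n))) (t n *\<^sub>R vs (\<phi> n)))
        (us (\<phi> n)) (\<xi>s n) = 0" for n
    proof -
      have "((\<lambda>s. blinfun_apply (Fop A G (us (\<phi> n) + s *\<^sub>R \<xi>s n) (ls (\<phi> n))) (vs (\<phi> n)))
          has_real_derivative 0) (at 0)"
        using crit[of "\<phi> n"] \<xi>s(1) by (auto simp: galerkin_critical_def)
      from DERIV_cmult[OF this, of "t n"] show ?thesis
        unfolding dir_deriv_def by (intro DERIV_imp_deriv) (simp add: blinfun.scaleR_right)
    qed
    then show ?thesis using D_lim by (simp add: LIMSEQ_const_iff)
  qed
  with that show thesis using \<phi> t uUo uv(2) lim F0 by blast
qed

text \<open>The interpolants of a nearly optimal \<open>u\<close> in \<open>Uo\<close> eventually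
  compete in the discrete supremum, and (LC) keeps their values from falling below that of
  \<open>u\<close> in the limit.\<close>

lemma lam_star_le_galerkin:
  assumes LC: "cond_LC iW iC A G Uo S Wr Sor Ir"
    and C: "cond_C iW iC Uo S Wr N Sor Ir"
    and L: "lam_star A G Uo S = ereal L"
    and x: "\<forall>\<^sub>F r in sequentially. lam_star A G (Sor r) (Scl Wr Sor r) = ereal (x r)"
    and e: "0 < e"
  shows "\<forall>\<^sub>F r in sequentially. L - e < x r"
proof -
  obtain \<delta> :: real where \<delta>: "0 < \<delta>" "\<And>u. u \<in> Uo \<Longrightarrow> lam A G S u \<ge> ereal L - ereal \<delta> \<Longrightarrow>
      liminf (\<lambda>r. lam A G (Scl Wr Sor r) (Ir r (toC iW iC u))) \<ge> lam A G S u"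
    using LC L unfolding cond_LC_def by auto
  \<comment> \<open>The bound by \<delta> makes (LC) applicable to \<open>u\<close>; the bound by
    \<open>e\<close> gives the required accuracy.\<close>
  define d where "d = min \<delta> e"
  have "ereal (L - d) < lam_star A G Uo S" using \<delta>(1) e L by (simp add: d_def)
  then obtain u where u: "u \<in> Uo" "ereal (L - d) < lam A G S u"
    unfolding lam_star_def less_SUP_iff by blast
  have "ereal L - ereal \<delta> \<le> ereal (L - d)" by (simp add: d_def)
  then have "ereal (L - d) < liminf (\<lambda>r. lam A G (Scl Wr Sor r) (Ir r (toC iW iC u)))"
    using less_le_trans[OF u(2) \<delta>(2)[OF u(1) order_trans[OF _ less_imp_le[OF u(2)]]]] by blast
  then have "\<forall>\<^sub>F r in sequentially. ereal (L - d) < lam A G (Scl Wr Sor r) (Ir r (toC iW iC u))"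
    by (rule less_LiminfD)
  moreover have "\<forall>\<^sub>F r in sequentially. Ir r (toC iW iC u) \<in> Sor r"
    using C u(1) unfolding cond_C_def by blast
  ultimately show ?thesis using x
  proof eventually_elim
    case (elim r)
    have "ereal (L - d) < ereal (x r)"
      using elim(1) lam_le_lam_star[OF elim(2), of A G "Scl Wr Sor r"] unfolding elim(3)
      by (rule less_le_trans)
    then show ?case by (simp add: d_def)
  qed
qed

section \<open>Convergence of the levels and the saddle-node point\<close>

theorem theorem2p5:
  fixes iW :: "'w::banach \<Rightarrow> 'x::real_vector"
    and iC :: "'c::{banach, ordered_real_vector} \<Rightarrow> 'x"
    and So Uo S :: "'w set"
    and A G :: "'w \<Rightarrow> 'w \<Rightarrow>\<^sub>L real"
    and Wr Sor :: "nat \<Rightarrow> 'w set"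
    and N :: "nat \<Rightarrow> nat"
    and Ir :: "nat \<Rightarrow> 'c \<Rightarrow> 'w"
    and c C :: real
  assumes S_def: "S = cone_S iW iC So"
    and setting: "setting iW iC So Uo A G"
    and R: "cond_R A G So Uo"
    and D: "cond_D G So S"
    and galerkin: "galerkin_spaces Wr N Ir"
    and C: "cond_C iW iC Uo S Wr N Sor Ir"
    and CQ: "cond_CQ A G Wr Sor"
    and CD: "cond_CD A G Uo S Wr Sor"
    and LC: "cond_LC iW iC A G Uo S Wr Sor Ir"
    and H: "cond_H A G Wr Sor"
    and c_pos: "0 < c"
    and bounds: "\<forall>\<^sub>F r in sequentially.
                   ereal c \<le> lam_star A G (Sor r) (Scl Wr Sor r) \<and>
                   lam_star A G (Sor r) (Scl Wr Sor r) \<le> ereal C"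
    and PS: "\<forall>l\<in>{c..C}. PS_e A G So S Wr Sor l"
  shows "\<exists>u\<in>Uo. \<exists>v\<in>S - {0}. \<exists>ls::real.
     lam_star A G Uo S = ereal ls \<and>
     c \<le> ls \<and>
     ls = Rq A G u v \<and>
     ereal (Rq A G u v) = (INF w\<in>S - {0}. ereal (Rq A G u w)) \<and>
     (INF w\<in>S - {0}. ereal (Rq A G u w)) = (SUP z\<in>Uo. INF w\<in>S - {0}. ereal (Rq A G z w)) \<and>
     Fop A G u ls = 0 \<and>
     (\<forall>\<xi>. blinfun_apply (DuF A G u ls \<xi>) v = 0) \<and>
     (\<forall>l>ls. \<forall>z\<in>Uo. Fop A G z l \<noteq> 0) \<and>
     maximal_one_sided_saddle_node A G Uo S u ls \<and>
     (\<lambda>r. lam_star A G (Sor r) (Scl Wr Sor r)) \<longlonglongrightarrow> ereal ls \<and>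
     (\<exists>\<phi> us vs t. strict_mono (\<phi> :: nat \<Rightarrow> nat) \<and>
        (\<forall>n. \<phi> n \<ge> 1 \<and> us n \<in> Sor (\<phi> n) \<and> vs n \<in> Sor (\<phi> n) \<and> t n > 0) \<and>
        us \<longlonglongrightarrow> u \<and>
        weakly_tendsto (\<lambda>n. t n *\<^sub>R vs n) v)"
proof -
  have cont: "continuous_on UNIV A" "continuous_on UNIV G" and UoSo: "Uo \<subseteq> So"
    using setting unfolding setting_def by auto
  have dense: "\<forall>\<xi>. \<exists>x. (\<forall>r\<ge>1. x r \<in> Wr r) \<and> x \<longlonglongrightarrow> \<xi>"
    using galerkin unfolding galerkin_spaces_def by blast
  have cone: "\<forall>r\<ge>1. pos_cone (Sor r)" using C[unfolded cond_C_def, THEN conjunct1] by simp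
  \<comment> \<open>\<open>real_of_ereal\<close> sends infinite values to 0, so \<open>x r\<close>
    is known to be the discrete level only for large \<open>r\<close>, where \<open>bounds\<close>
    gives finiteness.\<close>
  define x where "x r = real_of_ereal (lam_star A G (Sor r) (Scl Wr Sor r))" for r
  have "\<forall>\<^sub>F r in sequentially. x r \<in> {c..C} \<and>
      lam_star A G (Sor r) (Scl Wr Sor r) = ereal (x r) \<and>
      (\<exists>u v. galerkin_critical A G (Wr r) (Sor r) (x r) u v)"
    using bounds H[unfolded cond_H_def] eventually_ge_at_top[of 1]
  proof eventually_elim
    case (elim r)
    obtain l where l: "lam_star A G (Sor r) (Scl Wr Sor r) = ereal l"
      using elim(1) by (cases "lam_star A G (Sor r) (Scl Wr Sor r)") auto
    then have xr: "x r = l" and fin: "lam_star A G (Sor r) (Scl Wr Sor r) < \<infinity>"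
      by (simp_all add: x_def)
    have "\<exists>u v. galerkin_critical A G (Wr r) (Sor r) l u v"
    proof (rule galerkin_critical_pair[OF elim(3) cont C CQ l])
      show "\<exists>\<alpha>::real. ereal \<alpha> < lam_star A G (Sor r) (Scl Wr Sor r) \<and>
        (let K = {u \<in> Sor r. lam A G (Scl Wr Sor r) u \<ge> ereal \<alpha>} in
          compact (top_of_set (Wr r) closure_of K) \<and> top_of_set (Wr r) closure_of K \<subseteq> Sor r)"
        by (rule mp[OF conjunct1[OF elim(2)] fin])
      show "v \<in> Sor r" if "u \<in> Sor r" "v \<in> Scl Wr Sor r - {0}" "Rq A G u v = l"
        "\<forall>\<xi>\<in>Wr r. dir_deriv (\<lambda>w. Rq A G w v) u \<xi> = 0" for u v
        using bspec[OF bspec[OF conjunct2[OF elim(2)] that(1)] that(2)] that(3,4) l by simp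
    qed
    then show ?case using l xr elim(1) by simp
  qed
  then obtain r0 where r0: "\<And>r. r0 \<le> r \<Longrightarrow> x r \<in> {c..C}"
      "\<And>r. r0 \<le> r \<Longrightarrow> lam_star A G (Sor r) (Scl Wr Sor r) = ereal (x r)"
      "\<And>r. r0 \<le> r \<Longrightarrow> \<exists>u v. galerkin_critical A G (Wr r) (Sor r) (x r) u v"
    unfolding eventually_sequentially by blast
  obtain us vs where crit: "\<And>r. r0 \<le> r \<Longrightarrow> galerkin_critical A G (Wr r) (Sor r) (x r) (us r) (vs r)"
    using r0(3) by metis
  have lam_sol: "lam A G S z = ereal l" if "z \<in> Uo" "Fop A G z l = 0" "S - {0} \<noteq> {}" for z l
    using lam_solution[OF that(2) _ that(3)] D that(1) UoSo unfolding cond_D_def by blast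
  \<comment> \<open>Stated for every convergent subsequence of levels: it serves both to identify
    all subsequential limits and, with the identity subsequence, to produce the final pair.\<close>
  have limit: "\<exists>\<psi> t u v. strict_mono (\<psi> :: nat \<Rightarrow> nat) \<and> (\<forall>n. r0 \<le> \<psi> n \<and> 1 \<le> \<psi> n \<and> 0 < (t n :: real)) \<and>
      u \<in> Uo \<and> v \<in> S - {0} \<and> (\<lambda>n. us (\<psi> n)) \<longlonglongrightarrow> u \<and>
      weakly_tendsto (\<lambda>n. t n *\<^sub>R vs (\<psi> n)) v \<and>
      Fop A G u \<mu> = 0 \<and> (\<forall>\<xi>. blinfun_apply (DuF A G u \<mu> \<xi>) v = 0)"
    if \<phi>: "strict_mono \<phi>" and x\<phi>: "(x \<circ> \<phi>) \<longlonglongrightarrow> \<mu>" for \<phi> \<mu>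
  proof -
    \<comment> \<open>The shift by \<open>Suc r0\<close> ensures \<open>r0 \<le> rs n\<close> and
      \<open>1 \<le> rs n\<close> at once.\<close>
    define rs where "rs n = \<phi> (n + Suc r0)" for n
    have rs_mono: "strict_mono rs" using \<phi> by (simp add: rs_def strict_mono_def)
    have rs_ge: "Suc r0 \<le> rs n" for n
      using seq_suble[OF \<phi>, of "n + Suc r0"] by (simp add: rs_def)
    have x_lim: "(\<lambda>n. x (rs n)) \<longlonglongrightarrow> \<mu>"
      using LIMSEQ_ignore_initial_segment[OF x\<phi>, of "Suc r0"] by (simp add: rs_def)
    have "x (rs n) \<in> {c..C}" for n using r0(1) rs_ge[of n] by simp
    then have "\<mu> \<in> {c..C}" using closed_sequentially[OF closed_atLeastAtMost _ x_lim] by blast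
    then have PS_\<mu>: "PS_e A G So S Wr Sor \<mu>" using PS by blast
    have rs_pos: "1 \<le> rs n" for n using rs_ge[of n] by simp
    have crit_rs: "galerkin_critical A G (Wr (rs n)) (Sor (rs n)) (x (rs n)) (us (rs n)) (vs (rs n))" for n
      using crit rs_ge[of n] by simp
    obtain \<psi> t u v where lim: "strict_mono (\<psi> :: nat \<Rightarrow> nat)" "\<And>n. 0 < (t n :: real)"
        "u \<in> Uo" "v \<in> S - {0}" "(\<lambda>n. us (rs (\<psi> n))) \<longlonglongrightarrow> u"
        "weakly_tendsto (\<lambda>n. t n *\<^sub>R vs (rs (\<psi> n))) v"
        "Fop A G u \<mu> = 0" "\<And>\<xi>. blinfun_apply (DuF A G u \<mu> \<xi>) v = 0"
      by (rule critical_pairs_limit[OF cont R dense cone CD PS_\<mu> rs_pos filterlim_subseq[OF rs_mono]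
            x_lim crit_rs]) (rule that)
    have "strict_mono (rs \<circ> \<psi>)" using strict_mono_o[OF rs_mono lim(1)] .
    moreover have "r0 \<le> rs (\<psi> n) \<and> 1 \<le> rs (\<psi> n)" for n using rs_ge[of "\<psi> n"] by simp
    ultimately show ?thesis
      using lim
      by (intro exI[of _ "rs \<circ> \<psi>"] exI[of _ t] exI[of _ u] exI[of _ v]) simp
  qed
  \<comment> \<open>The limit level is that of a solution in \<open>Uo\<close>, hence the value of
    \<open>lam\<close> there.\<close>
  have limit_le: "ereal \<mu> \<le> lam_star A G Uo S"
    if \<phi>: "strict_mono \<phi>" "(x \<circ> \<phi>) \<longlonglongrightarrow> \<mu>" for \<phi> \<mu>
  proof -
    obtain u v where "u \<in> Uo" "v \<in> S - {0}" "Fop A G u \<mu> = 0"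
      using limit[OF \<phi>] by blast
    then have "u \<in> Uo" "lam A G S u = ereal \<mu>" using lam_sol[of u \<mu>] by blast+
    then show ?thesis using lam_le_lam_star[of u Uo A G S] by simp
  qed
  \<comment> \<open>A subsequential limit of the levels bounds the supremum from below, so it is not
    -\<infinity>; (LC) excludes +\<infinity>.\<close>
  obtain L where L: "lam_star A G Uo S = ereal L"
  proof -
    have "\<forall>n. x (n + r0) \<in> {c..C}" using r0(1) by simp
    from seq_compactE[OF compact_imp_seq_compact[OF compact_Icc] this]
    obtain \<mu> \<phi> where "strict_mono (\<phi> :: nat \<Rightarrow> nat)" "((\<lambda>n. x (n + r0)) \<circ> \<phi>) \<longlonglongrightarrow> \<mu>"
      by metis
    then have "ereal \<mu> \<le> lam_star A G Uo S"
      using limit_le[of "\<lambda>n. \<phi> n + r0" \<mu>] by (simp add: o_def strict_mono_def)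
    moreover have "lam_star A G Uo S < \<infinity>" using LC by (simp add: cond_LC_def)
    ultimately show thesis using that by (cases "lam_star A G Uo S") auto
  qed
  have x_ev: "\<forall>\<^sub>F r in sequentially. lam_star A G (Sor r) (Scl Wr Sor r) = ereal (x r)"
    using r0(2) unfolding eventually_sequentially by blast
  \<comment> \<open>Each subsequential limit \<mu> is pinned from two sides:
    \<open>lam_star_le_galerkin\<close> gives \<open>L \<le> \<mu>\<close>, and
    \<open>limit_le\<close> gives \<open>\<mu> \<le> L\<close>.\<close>
  have x_lim: "x \<longlonglongrightarrow> L"
  proof (rule real_tendsto_by_subseq_limits[of x c C])
    show "\<forall>\<^sub>F r in sequentially. x r \<in> {c..C}"
      using r0(1) unfolding eventually_sequentially by blast
    fix \<phi> \<mu> assume \<phi>: "strict_mono (\<phi> :: nat \<Rightarrow> nat)" "(x \<circ> \<phi>) \<longlonglongrightarrow> \<mu>"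
    have "L \<le> \<mu>"
    proof (rule field_le_epsilon)
      fix e :: real assume "0 < e"
      have "\<forall>\<^sub>F n in sequentially. L - e \<le> (x \<circ> \<phi>) n"
        using eventually_subseq[OF \<phi>(1) lam_star_le_galerkin[OF LC C L x_ev \<open>0 < e\<close>]]
        by (rule eventually_mono) simp
      from tendsto_lowerbound[OF \<phi>(2) this trivial_limit_sequentially]
      show "L \<le> \<mu> + e" by simp
    qed
    moreover have "\<mu> \<le> L" using limit_le[OF \<phi>] unfolding L by simp
    ultimately show "\<mu> = L" by simp
  qed
  have "strict_mono (id :: nat \<Rightarrow> nat)" "(x \<circ> id) \<longlonglongrightarrow> L"
    using x_lim by (simp_all add: strict_mono_def)
  from limit[OF this] obtain \<psi> t u v where \<psi>: "strict_mono (\<psi> :: nat \<Rightarrow> nat)"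
      "\<forall>n. r0 \<le> \<psi> n \<and> 1 \<le> \<psi> n \<and> 0 < (t n :: real)"
    and uv: "u \<in> Uo" "v \<in> S - {0}"
    and lim: "(\<lambda>n. us (\<psi> n)) \<longlonglongrightarrow> u" "weakly_tendsto (\<lambda>n. t n *\<^sub>R vs (\<psi> n)) v"
    and F0: "Fop A G u L = 0" and D0: "\<forall>\<xi>. blinfun_apply (DuF A G u L \<xi>) v = 0"
    by (elim exE conjE) (rule that)
  have S_ne: "S - {0} \<noteq> {}" using uv(2) by blast
  have lamu: "lam A G S u = ereal L" using lam_sol[OF uv(1) F0 S_ne] .
  have Guv: "0 < blinfun_apply (G u) v" using bspec[OF bspec[OF D[unfolded cond_D_def]] uv(2)] uv(1) UoSo by blast
  have Rq: "L = Rq A G u v"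
    using Fop_apply[of A G u L v] F0 Guv by (simp add: Rq_def field_simps)
  have no_sol: "Fop A G z l \<noteq> 0" if "L < l" "z \<in> Uo" for l z
  proof
    assume "Fop A G z l = 0"
    then have "lam A G S z = ereal l" using lam_sol[OF that(2) _ S_ne] by blast
    then have "ereal l \<le> ereal L" using L lam_le_lam_star[OF that(2), of A G S] by simp
    then show False using that(1) by simp
  qed
  have "one_sided_saddle_node A G Uo S u L"
    unfolding one_sided_saddle_node_def singular_solution_def is_solution_def
  proof (intro conjI)
    show "\<exists>v\<in>S - {0}. \<forall>\<xi>. blinfun_apply (DuF A G u L \<xi>) v = 0" using uv(2) D0 by blast
    show "\<exists>\<epsilon>>0. \<exists>V. open V \<and> u \<in> V \<and> (\<forall>l\<in>{L<..<L + \<epsilon>}. \<forall>z\<in>Uo \<inter> V. Fop A G z l \<noteq> 0)"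
      \<comment> \<open>Solutions above \<open>L\<close> are excluded in all of \<open>Uo\<close>,
        so any \<epsilon> and the whole space as neighbourhood will do.\<close>
      using no_sol by (intro exI[of _ 1] exI[of _ UNIV] conjI) auto
  qed (fact uv(1) F0)+
  moreover have "l \<le> L" if saddle: "one_sided_saddle_node A G Uo S z l" for z l
  proof (rule leI, rule notI)
    assume "L < l"
    have "z \<in> Uo \<and> Fop A G z l = 0"
      using saddle
      unfolding one_sided_saddle_node_def singular_solution_def is_solution_def by (elim conjE) simp
    then show False using no_sol[OF \<open>L < l\<close>] by blast
  qed
  ultimately have "maximal_one_sided_saddle_node A G Uo S u L"
    unfolding maximal_one_sided_saddle_node_def by simp
  moreover have "c \<le> L"
  proof (rule tendsto_lowerbound[OF x_lim])
    show "\<forall>\<^sub>F r in sequentially. c \<le> x r"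
      using eventually_ge_at_top[of r0] by eventually_elim (use r0(1) in simp)
  qed simp
  moreover have "(\<lambda>r. lam_star A G (Sor r) (Scl Wr Sor r)) \<longlonglongrightarrow> ereal L"
    by (rule iffD2[OF tendsto_cong[OF x_ev] tendsto_ereal[OF x_lim]])
  moreover have "\<forall>n. \<psi> n \<ge> 1 \<and> us (\<psi> n) \<in> Sor (\<psi> n) \<and> vs (\<psi> n) \<in> Sor (\<psi> n) \<and> t n > 0"
    using \<psi>(2) crit by (simp add: galerkin_critical_def)
  moreover have "(INF w\<in>S - {0}. ereal (Rq A G u w)) = ereal L"
    using lamu by (simp add: lam_def)
  moreover have "(SUP z\<in>Uo. INF w\<in>S - {0}. ereal (Rq A G z w)) = ereal L"
    using L by (simp add: lam_star_def lam_def)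
  ultimately show ?thesis
    using L Rq F0 D0 no_sol \<psi>(1) lim
    by (intro bexI[OF _ uv(1)] bexI[OF _ uv(2)] exI[of _ L] conjI exI[of _ \<psi>] exI[of _ "\<lambda>n. us (\<psi> n)"]
        exI[of _ "\<lambda>n. vs (\<psi> n)"] exI[of _ t]) simp_all
qed

end
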